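(* Let $d\ge3$ and $n\in\mathbb N_0$. For each $0\le m\le n$, let $A_m=((A_m)_{i,j})_{i,j\ge1}$ be an infinite, symmetric, positive semidefinite matrix with finitely many nonzero entries, and assume in addition that all entries of the first row and first column of $A_0$ are zero. Define $$K(x,y,z)=\sum_{m=0}^{n}\operatorname{Tr}\big(S_m^d(x,y,z)A_m\big)=\sum_{m=0}^n\sum_{i,j\ge1}(S_m^d(x,y,z))_{i,j}(A_m)_{i,j}.$$ Then $\sigma$ is a minimizer of $I_K(\mu)=\iiint K(x,y,z)\,d\mu(x)d\mu(y)d\mu(z)$ over $\mu\in\mathcal P(\mathbb S^{d-1})$.
   Context: $\mathbb S^{d-1}$ is the unit sphere in $\mathbb R^d$, $\mathcal P(\mathbb S^{d-1})$ its Borel probability measures, $\sigma$ the normalized surface measure. $P_m^h$ denotes the Gegenbauer polynomial of degree $m$ for $\mathbb S^{h-1}$, i.e. the polynomials orthogonal on $[-1,1]$ with respect to $(1-t^2)^{(h-3)/2}dt$, normalized by $P_m^h(1)=1$. For $x,y,z\in\mathbb S^{d-1}$ put $u=\langle y,z\rangle$, $v=\langle x,z\rangle$, $t=\langle x,y\rangle$, and define the polynomial $Q_m^d(u,v,t)=((1-u^2)(1-v^2))^{m/2}P_m^{d-1}\Big(\frac{t-uv}{\sqrt{(1-u^2)(1-v^2)}}\Big)$ and, for $m,i,j\in\mathbb N_0$, $Y_{m,i,j}^d(x,y,z)=P_i^{d+2m}(u)P_j^{d+2m}(v)Q_m^d(u,v,t)$. Let $S_{m,i,j}^d(x,y,z)=\frac16\sum_\pi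 Y_{m,i,j}^d(\pi(x),\pi(y),\pi(z))$, the average over all permutations $\pi$ of the three arguments, and let $S_m^d(x,y,z)$ be the infinite matrix with $(S_m^d)_{i+1,j+1}=S^d_{m,i,j}$, $i,j\ge0$. An infinite symmetric matrix is positive semidefinite if all its finite principal submatrices are. *)

theory Defs
  imports "HOL-Probability.Probability" "HOL-Computational_Algebra.Polynomial"
begin

text \<open>Gegenbauer polynomial of degree m for the sphere S^(h-1): the polynomial of
degree m orthogonal on [-1,1] to all polynomials of lower degree with respect to
the weight (1-t^2)^((h-3)/2), normalized by P(1) = 1.\<close>
definition gegenbauer_poly :: "nat \<Rightarrow> nat \<Rightarrow> real poly" where
  "gegenbauer_poly h m = (THE p. degree p = m \<and> poly p 1 = 1 \<and>
     (\<forall>q. degree q < m \<longrightarrow>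
        (LINT t:{-1..1}|lborel. (1 - t\<^sup>2) powr ((real h - 3) / 2) * poly p t * poly q t) = 0))"

definition gegenbauer :: "nat \<Rightarrow> nat \<Rightarrow> real \<Rightarrow> real" where
  "gegenbauer h m t = poly (gegenbauer_poly h m) t"

definition Qpoly :: "nat \<Rightarrow> nat \<Rightarrow> real \<Rightarrow> real \<Rightarrow> real \<Rightarrow> real" where
  "Qpoly d m u v t = sqrt ((1 - u\<^sup>2) * (1 - v\<^sup>2)) ^ m *
     gegenbauer (d - 1) m ((t - u * v) / sqrt ((1 - u\<^sup>2) * (1 - v\<^sup>2)))"

definition Yfun :: "nat \<Rightarrow> nat \<Rightarrow> nat \<Rightarrow> nat \<Rightarrow> 'a::real_inner \<Rightarrow> 'a \<Rightarrow> 'a \<Rightarrow> real" where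
  "Yfun d m i j x y z = gegenbauer (d + 2 * m) i (inner y z) * gegenbauer (d + 2 * m) j (inner x z)
       * Qpoly d m (inner y z) (inner x z) (inner x y)"

definition Sfun :: "nat \<Rightarrow> nat \<Rightarrow> nat \<Rightarrow> nat \<Rightarrow> 'a::real_inner \<Rightarrow> 'a \<Rightarrow> 'a \<Rightarrow> real" where
  "Sfun d m i j x y z = (Yfun d m i j x y z + Yfun d m i j x z y + Yfun d m i j y x z
       + Yfun d m i j y z x + Yfun d m i j z x y + Yfun d m i j z y x) / 6"

text \<open>Entry (i,j) of the index-shifted matrix: A i j stands for the paper's (A)_(i+1,j+1).\<close>
definition psd_inf :: "(nat \<Rightarrow> nat \<Rightarrow> real) \<Rightarrow> bool" where
  "psd_inf A \<longleftrightarrow> (\<forall>i j. A i j = A j i) \<and>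
     (\<forall>I. finite I \<longrightarrow> (\<forall>c. 0 \<le> (\<Sum>i\<in>I. \<Sum>j\<in>I. c i * c j * A i j)))"

definition kernelK :: "(nat \<Rightarrow> nat \<Rightarrow> nat \<Rightarrow> real) \<Rightarrow> nat \<Rightarrow> 'a::euclidean_space \<Rightarrow> 'a \<Rightarrow> 'a \<Rightarrow> real" where
  "kernelK A n x y z = (\<Sum>m\<le>n. \<Sum>(i,j)\<in>{(i,j). A m i j \<noteq> 0}.
       Sfun DIM('a) m i j x y z * A m i j)"

definition energy :: "('a \<Rightarrow> 'a \<Rightarrow> 'a \<Rightarrow> real) \<Rightarrow> 'a measure \<Rightarrow> real" where
  "energy K \<mu> = (\<integral>z. (\<integral>y. (\<integral>x. K x y z \<partial>\<mu>) \<partial>\<mu>) \<partial>\<mu>)"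

text \<open>Normalized surface measure on the unit sphere, as the radial projection of the
uniform probability measure on the unit ball (cone measure).\<close>
definition sphere_sigma :: "'a::euclidean_space measure" where
  "sphere_sigma = distr (uniform_measure lborel (ball 0 1)) borel (\<lambda>x. x /\<^sub>R norm x)"

definition prob_on_sphere :: "'a::euclidean_space measure \<Rightarrow> bool" where
  "prob_on_sphere \<mu> \<longleftrightarrow> prob_space \<mu> \<and> sets \<mu> = sets borel \<and> emeasure \<mu> (sphere 0 1) = 1"

end

theory Submission
  imports Defs
begin

text \<open>For fixed \<open>z\<close>, \<open>Q\<^sub>m\<close> is the Gegenbauer kernel of the directions of \<open>x\<close> and \<open>y\<close> orthogonal to
\<open>z\<close>, scaled by the lengths of these components. By rotation invariance, convolving two Gegenbauer
kernels of the same degree over the sphere orthogonal to \<open>z\<close> gives a positive multiple of the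
kernel. So \<open>\<integral>\<integral> Y\<^sub>m\<^sub>i\<^sub>j d\<mu>(x) d\<mu>(y)\<close> is, up to a positive factor, a Gram matrix in \<open>i, j\<close>, and its
pairing with a positive semidefinite matrix is nonnegative. Symmetrization does not change the
energy, hence \<open>I\<^sub>K(\<mu>) \<ge> 0\<close>. For \<open>\<sigma>\<close> every term vanishes: the kernel of degree \<open>m \<ge> 1\<close> has
mean zero over the sphere orthogonal to \<open>z\<close>, and for \<open>m = 0\<close> only \<open>P\<^sub>j\<close> with \<open>j \<ge> 1\<close> remain.\<close>

text \<open>The Gegenbauer polynomials are given only by orthogonality with respect to a weight, and
  \<open>sphere_sigma\<close> only as an image of Lebesgue measure. The two are linked through
  moments: reflection invariance alone forces the moments of one coordinate to satisfy a two-step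
  recurrence, and integration by parts gives the same recurrence for the weight. Hence integrals of
  polynomials in one coordinate are weighted integrals over [-1,1]; neither spherical harmonics nor
  a surface density enters. The convolution of two kernels of degree m is then a polynomial of
  degree at most m in the inner product, orthogonal to all lower degrees, so by uniqueness it is a
  multiple of the kernel, with factor the mean of the squared polynomial. Reflections suffice in
  place of rotations because they exchange any two vectors of equal length. The condition d >= 3
  gives the hyperplane dimension h >= 2, so that the exponent (h - 3)/2 is at least -1/2 and the
  weight is integrable. At x = z and x = -z there is no direction orthogonal to z; for m >= 1 the
  length factor is zero there, and for m = 0 the kernel is constant.\<close>

subsection \<open>Gegenbauer polynomials\<close>

definition gegen_weight :: "nat \<Rightarrow> real \<Rightarrow> real" where
  "gegen_weight h t = (1 - t\<^sup>2) powr ((real h - 3) / 2)"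

definition gegen_int :: "nat \<Rightarrow> real poly \<Rightarrow> real" where
  "gegen_int h p = (LINT t:{-1..1}|lborel. gegen_weight h t * poly p t)"

lemma gegen_weight_borel [measurable]: "gegen_weight h \<in> borel_measurable borel"
  unfolding gegen_weight_def by measurable

lemma borel_measurable_poly [measurable (raw)]:
  fixes p :: "real poly"
  assumes "f \<in> borel_measurable M"
  shows "(\<lambda>x. poly p (f x)) \<in> borel_measurable M"
proof -
  have "poly p \<in> borel_measurable borel"
    by (intro borel_measurable_continuous_onI continuous_intros)
  then show ?thesis using assms by (rule measurable_compose_rev)
qed

lemma gegen_weight_nonneg: "gegen_weight h t \<ge> 0"
  by (simp add: gegen_weight_def)

lemma gegen_weight_pos: "-1 < t \<Longrightarrow> t < 1 \<Longrightarrow> gegen_weight h t > 0"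
  by (auto simp: gegen_weight_def abs_square_eq_1 power2_eq_1_iff)

lemma poly_bounded_on_unit:
  fixes p :: "real poly"
  obtains B where "B \<ge> 0" "\<And>t. -1 \<le> t \<Longrightarrow> t \<le> 1 \<Longrightarrow> \<bar>poly p t\<bar> \<le> B"
proof -
  have "compact (poly p ` {-1..1})"
    by (intro compact_continuous_image continuous_intros) auto
  then obtain B where B: "\<And>y. y \<in> poly p ` {-1..1} \<Longrightarrow> norm y \<le> B"
    using compact_imp_bounded bounded_iff by metis
  from B[of "poly p 0"] have "B \<ge> 0"
    by (smt (verit) atLeastAtMost_iff imageI norm_ge_zero)
  then show ?thesis using B that by force
qed

text \<open>The exponent -1/2 is the most singular one for h >= 2. This weight is the derivative of
  arcsin, and it dominates the weights of all larger h.\<close>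

lemma gegen_weight_integrable_2: "set_integrable lborel {-1..1} (gegen_weight 2)"
proof -
  have w: "gegen_weight 2 t = inverse (sqrt (1 - t\<^sup>2))" if "-1 < t" "t < 1" for t
  proof -
    have "t\<^sup>2 < 1" using that by (simp add: abs_square_less_1)
    then show ?thesis
      by (simp add: gegen_weight_def powr_minus powr_half_sqrt)
  qed
  have "(gegen_weight 2 has_integral (arcsin 1 - arcsin (-1))) {-1..1}"
  proof (rule fundamental_theorem_of_calculus_interior)
    fix t :: real assume "t \<in> {-1<..<1}"
    then show "(arcsin has_vector_derivative gegen_weight 2 t) (at t)"
      using DERIV_arcsin[of t] w[of t]
      by (simp add: has_real_derivative_iff_has_vector_derivative)
  qed (auto intro: continuous_on_arcsin')
  then have "gegen_weight 2 absolutely_integrable_on {-1..1}"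
    by (intro nonnegative_absolutely_integrable_1)
       (auto simp: gegen_weight_nonneg has_integral_integrable)
  then show ?thesis
    unfolding set_integrable_def by (subst (asm) integrable_completion) auto
qed

lemma gegen_integrable:
  assumes "h \<ge> 2"
  shows "set_integrable lborel {-1..1} (\<lambda>t. gegen_weight h t * poly p t)"
proof -
  obtain B where B: "B \<ge> 0" "\<And>t. -1 \<le> t \<Longrightarrow> t \<le> 1 \<Longrightarrow> \<bar>poly p t\<bar> \<le> B"
    using poly_bounded_on_unit[of p] by blast
  have w: "gegen_weight h t \<le> gegen_weight 2 t" if "-1 \<le> t" "t \<le> 1" for t
  proof (cases "t\<^sup>2 = 1")
    case False
    have "t\<^sup>2 \<le> 1" using that by (simp add: abs_square_le_1)
    with False have "0 < 1 - t\<^sup>2" "1 - t\<^sup>2 \<le> 1" by auto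
    then show ?thesis
      unfolding gegen_weight_def using assms by (intro powr_mono') auto
  \<comment> \<open>At the endpoints both weights are 0, since \<open>0 powr a = 0\<close> for every
    exponent.\<close>
  qed (simp add: gegen_weight_def)
  have "set_integrable lborel {-1..1} (\<lambda>t. B * gegen_weight 2 t)"
    using gegen_weight_integrable_2 by simp
  then show ?thesis
  proof (rule set_integrable_bound)
    show "set_borel_measurable lborel {-1..1} (\<lambda>t. gegen_weight h t * poly p t)"
      unfolding set_borel_measurable_def by measurable
    show "AE t in lborel. t \<in> {-1..1} \<longrightarrow>
        norm (gegen_weight h t * poly p t) \<le> norm (B * gegen_weight 2 t)"
    proof (intro AE_I2 impI)
      fix t :: real assume t: "t \<in> {-1..1}"
      have "gegen_weight h t * \<bar>poly p t\<bar> \<le> gegen_weight 2 t * B"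
        using t w[of t] B by (intro mult_mono) (auto simp: gegen_weight_nonneg)
      then show "norm (gegen_weight h t * poly p t) \<le> norm (B * gegen_weight 2 t)"
        using B(1) gegen_weight_nonneg by (simp add: abs_mult mult.commute)
    qed
  qed
qed

section \<open>The weighted integral as a linear functional on polynomials, and its moments\<close>

lemma gegen_int_add: "h \<ge> 2 \<Longrightarrow> gegen_int h (p + q) = gegen_int h p + gegen_int h q"
  unfolding gegen_int_def
  by (subst set_integral_add(2)[symmetric]) (auto simp: gegen_integrable distrib_left)

lemma gegen_int_smult: "gegen_int h (smult c p) = c * gegen_int h p"
  unfolding gegen_int_def
  by (subst set_integral_mult_right[symmetric]) (auto simp: algebra_simps)

lemma gegen_int_0 [simp]: "gegen_int h 0 = 0"
  using gegen_int_smult[of h 0 0] by simp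

lemma gegen_int_diff: "h \<ge> 2 \<Longrightarrow> gegen_int h (p - q) = gegen_int h p - gegen_int h q"
  using gegen_int_add[of h p "smult (-1) q"] gegen_int_smult[of h "-1" q] by simp

lemma gegen_int_sum:
  assumes "h \<ge> 2"
  shows "gegen_int h (\<Sum>i\<in>I. p i) = (\<Sum>i\<in>I. gegen_int h (p i))"
  by (induction I rule: infinite_finite_induct) (auto simp: gegen_int_add[OF assms])

lemma gegen_int_poly:
  assumes "h \<ge> 2"
  shows "gegen_int h p = (\<Sum>i\<le>degree p. coeff p i * gegen_int h (monom 1 i))"
proof -
  have "gegen_int h p = gegen_int h (\<Sum>i\<le>degree p. smult (coeff p i) (monom 1 i))"
    by (simp add: smult_monom poly_as_sum_of_monoms)
  then show ?thesis by (simp add: gegen_int_sum[OF assms] gegen_int_smult)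
qed

text \<open>A vanishing integral would make the polynomial zero almost everywhere on the open
  interval, where the weight is positive, but it has only finitely many roots.\<close>

lemma gegen_int_pos:
  assumes h: "h \<ge> 2" and "p \<noteq> 0" and nn: "\<And>t. -1 \<le> t \<Longrightarrow> t \<le> 1 \<Longrightarrow> poly p t \<ge> 0"
  shows "gegen_int h p > 0"
proof -
  let ?f = "\<lambda>t. indicator {-1..1} t *\<^sub>R (gegen_weight h t * poly p t)"
  have int: "integrable lborel ?f"
    using gegen_integrable[OF h, of p] by (simp add: set_integrable_def)
  have nonneg: "?f t \<ge> 0" for t
    using nn[of t] gegen_weight_nonneg[of h t] by (auto simp: indicator_def)
  have eq: "gegen_int h p = integral\<^sup>L lborel ?f"
    by (simp add: gegen_int_def set_lebesgue_integral_def)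
  have "gegen_int h p \<noteq> 0"
  proof
    assume "gegen_int h p = 0"
    then have ae0: "AE t in lborel. ?f t = 0"
      using integral_nonneg_eq_0_iff_AE[OF int] nonneg eq by simp
    have fin: "finite {t. poly p t = 0}" by (rule poly_roots_finite[OF \<open>p \<noteq> 0\<close>])
    have "AE t in lborel. t \<notin> {t. poly p t = 0}"
      using fin by (intro AE_not_in finite_imp_null_set_lborel)
    with ae0 have "AE t in lborel. t \<notin> {-1<..<1::real}"
    proof eventually_elim
      case (elim t)
      then show ?case using gegen_weight_pos[of t h] by (auto simp: indicator_def)
    qed
    then have "emeasure lborel {-1<..<1::real} = 0"
      by (subst (asm) AE_iff_null_sets[symmetric]) auto
    moreover have "emeasure lborel {-1<..<1::real} = 2" by simp
    ultimately show False by (metis zero_neq_numeral)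
  qed
  moreover have "gegen_int h p \<ge> 0"
    unfolding eq by (rule integral_nonneg_AE) (use nonneg in auto)
  ultimately show ?thesis by simp
qed

text \<open>The function \<open>?F\<close> vanishes at both endpoints, because its exponent
  \<open>g\<close> is positive, and its derivative is the weight times \<open>q\<close>. For j = 0
  the factor j hides the truncated exponent j - 1.\<close>

lemma gegen_int_ibp:
  assumes h: "h \<ge> 2"
  shows "real j * gegen_int h (monom 1 (j - 1)) = (real j + real h - 1) * gegen_int h (monom 1 (j + 1))"
proof -
  define g where "g = (real h - 1) / 2"
  have g: "g > 0" using h by (simp add: g_def)
  let ?F = "\<lambda>t::real. t ^ j * (1 - t\<^sup>2) powr g"
  define q where "q = smult (real j) (monom 1 (j-1)) - smult (real j + real h - 1) (monom 1 (j + 1))"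
  have "((\<lambda>t. gegen_weight h t * poly q t) has_integral (?F 1 - ?F (-1))) {-1..1}"
  proof (rule fundamental_theorem_of_calculus_interior)
    show "continuous_on {-1..1} ?F"
      using g by (intro continuous_on_mult continuous_on_powr' continuous_intros) (auto simp: abs_square_le_1)
    fix t :: real assume t: "t \<in> {-1<..<1}"
    then have t2: "t\<^sup>2 < 1" by (simp add: abs_square_less_1 abs_less_iff)
    have split: "(1 - t\<^sup>2) powr g = (1 - t\<^sup>2) * gegen_weight h t"
    proof -
      have "g = 1 + (real h - 3) / 2" by (simp add: g_def field_simps)
      then show ?thesis using t2 by (simp add: gegen_weight_def powr_add)
    qed
    have w2: "(1 - t\<^sup>2) powr (g - 1) = gegen_weight h t"
      by (simp add: gegen_weight_def g_def field_simps)
    have "(?F has_real_derivative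
        (real j * t ^ (j - 1) * (1 - t\<^sup>2) powr g + t ^ j * (g * (1 - t\<^sup>2) powr (g - 1) * (- 2 * t)))) (at t)"
      using t2 by (auto intro!: derivative_eq_intros simp: algebra_simps)
    also have "real j * t ^ (j - 1) * (1 - t\<^sup>2) powr g + t ^ j * (g * (1 - t\<^sup>2) powr (g - 1) * (- 2 * t))
        = gegen_weight h t * (real j * t ^ (j - 1) * (1 - t\<^sup>2) - (real h - 1) * t ^ (j+1))"
      unfolding split w2 by (simp add: g_def field_simps)
    also have "real j * t ^ (j - 1) * (1 - t\<^sup>2) - (real h - 1) * t ^ (j+1) = poly q t"
      by (cases j) (auto simp: q_def poly_monom algebra_simps power2_eq_square)
    finally show "(?F has_vector_derivative gegen_weight h t * poly q t) (at t)"
      by (simp add: has_real_derivative_iff_has_vector_derivative)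
  qed auto
  then have "integral {-1..1} (\<lambda>t. gegen_weight h t * poly q t) = 0"
    by (simp add: integral_unique)
  then have "gegen_int h q = 0"
    using set_borel_integral_eq_integral(2)[OF gegen_integrable[OF h, of q]]
    by (simp add: gegen_int_def)
  then show ?thesis
    by (simp add: q_def gegen_int_diff[OF h] gegen_int_smult)
qed

text \<open>The recurrence at j = 0 kills the first moment, and its later instances pass this on in
  steps of two.\<close>

lemma gegen_int_odd:
  assumes h: "h \<ge> 2"
  shows "gegen_int h (monom 1 (2 * k + 1)) = 0"
proof (induction k)
  case 0
  then show ?case using gegen_int_ibp[OF h, of 0] h by simp
next
  case (Suc k)
  then show ?case using gegen_int_ibp[OF h, of "2 * k + 2"] h
    by (simp add: numeral_eq_Suc)
qed

lemma gegen_int_even: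
  assumes h: "h \<ge> 2"
  shows "(real k + 1) * gegen_int h (monom 1 k) = (real k + real h) * gegen_int h (monom 1 (k + 2))"
  using gegen_int_ibp[OF h, of "k + 1"] by (simp add: algebra_simps)

section \<open>Existence and uniqueness of the orthogonal polynomials\<close>

definition gegen_orth :: "nat \<Rightarrow> nat \<Rightarrow> real poly \<Rightarrow> bool" where
  "gegen_orth h m p \<longleftrightarrow> (\<forall>q. degree q < m \<longrightarrow> gegen_int h (p * q) = 0)"

lemma gegen_orth_diff_smult:
  "h \<ge> 2 \<Longrightarrow> gegen_orth h m p \<Longrightarrow> gegen_orth h m q \<Longrightarrow> gegen_orth h m (p - smult c q)"
  by (simp add: gegen_orth_def left_diff_distrib gegen_int_diff gegen_int_smult)

text \<open>Such a \<open>p\<close> is orthogonal to itself. The disjunct \<open>p = 0\<close>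
  covers m = 0, since the zero polynomial has degree 0 and not a degree below 0.\<close>

lemma gegen_orth_self_eq_0:
  assumes h: "h \<ge> 2" and "gegen_orth h m p" "p = 0 \<or> degree p < m"
  shows "p = 0"
proof (rule ccontr)
  assume "p \<noteq> 0"
  then have "gegen_int h (p * p) > 0" by (intro gegen_int_pos[OF h]) auto
  with assms \<open>p \<noteq> 0\<close> show False by (auto simp: gegen_orth_def)
qed

text \<open>The multiplier contains \<open>coeff p (degree q)\<close> and not the leading
  coefficient of \<open>p\<close>, so it is 0 when \<open>p\<close> already has the smaller
  degree.\<close>

lemma degree_diff_smult_lead:
  fixes p q :: "real poly"
  assumes "degree p \<le> degree q" "q \<noteq> 0"
  shows "p - smult (coeff p (degree q) / lead_coeff q) q = 0
    \<or> degree (p - smult (coeff p (degree q) / lead_coeff q) q) < degree q"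
    (is "?r = 0 \<or> _")
proof -
  have "degree ?r \<le> degree q"
    using assms(1) by (intro degree_diff_le) (auto intro: order_trans[OF degree_smult_le])
  moreover have "coeff ?r (degree q) = 0" using assms(2) by simp
  ultimately show ?thesis
    by (metis eq_zero_or_degree_less)
qed

text \<open>Cancelling the top coefficient leaves an orthogonal polynomial of lower degree, which is
  therefore zero.\<close>

lemma gegen_orth_unique:
  assumes h: "h \<ge> 2" and "gegen_orth h (degree q) p" "gegen_orth h (degree q) q" "degree p \<le> degree q" "q \<noteq> 0"
  shows "p = smult (coeff p (degree q) / lead_coeff q) q"
  using gegen_orth_self_eq_0[OF h gegen_orth_diff_smult[OF h assms(2,3)] degree_diff_smult_lead[OF assms(4,5)]]
  by simp

text \<open>Gram-Schmidt. The induction hypothesis is used twice: for the monomial of degree m,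
  which yields the next orthogonal polynomial \<open>p\<close>, and for \<open>f\<close>, whose
  remainder then loses its component along \<open>p\<close>.\<close>

lemma gegen_projection:
  assumes h: "h \<ge> 2"
  shows "\<exists>r. (r = 0 \<or> degree r < m) \<and> gegen_orth h m (f - r)"
proof (induction m arbitrary: f)
  case 0
  then show ?case by (auto simp: gegen_orth_def)
next
  case (Suc m)
  obtain s where s: "s = 0 \<or> degree s < m" "gegen_orth h m (monom 1 m - s)"
    using Suc by blast
  define p where "p = monom 1 m - s"
  have "coeff p m = 1" using s(1) by (auto simp: p_def coeff_eq_0)
  moreover have "degree p \<le> m"
    unfolding p_def using s(1) by (intro degree_diff_le) (auto simp: degree_monom_le)
  ultimately have deg: "degree p = m" by (metis le_degree order_antisym zero_neq_one)
  have "p \<noteq> 0" using \<open>coeff p m = 1\<close> by auto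
  have pp: "gegen_int h (p * p) > 0" using \<open>p \<noteq> 0\<close> by (intro gegen_int_pos[OF h]) auto
  obtain r where r: "r = 0 \<or> degree r < m" "gegen_orth h m (f - r)"
    using Suc by blast
  define c where "c = gegen_int h ((f - r) * p) / gegen_int h (p * p)"
  have "degree (r + smult c p) < Suc m"
    using r(1) deg by (intro le_imp_less_Suc degree_add_le) (auto intro: order_trans[OF degree_smult_le])
  moreover have "gegen_orth h (Suc m) (f - (r + smult c p))"
    unfolding gegen_orth_def
  proof (intro allI impI)
    fix q :: "real poly" assume "degree q < Suc m"
    \<comment> \<open>The test polynomial is split into a multiple of \<open>p\<close> and a part of
      degree below m; the choice of \<open>c\<close> deals with the former, orthogonality with the
      latter.\<close>
    define q0 where "q0 = q - smult (coeff q (degree p) / lead_coeff p) p"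
    obtain a where a: "q = smult a p + q0" by (simp add: q0_def)
    have q0: "q0 = 0 \<or> degree q0 < m"
      using degree_diff_smult_lead[of q p] \<open>p \<noteq> 0\<close> \<open>degree q < Suc m\<close> deg by (simp add: q0_def)
    have z: "gegen_int h (p * q0) = 0" "gegen_int h ((f - r) * q0) = 0"
      using q0 r(2) s(2) by (auto simp: gegen_orth_def p_def)
    have "(f - (r + smult c p)) * q =
       smult a ((f - r) * p) - smult (a * c) (p * p) + (f - r) * q0 - smult c (p * q0)"
      unfolding a by (simp add: algebra_simps smult_add_right smult_diff_right)
    then have "gegen_int h ((f - (r + smult c p)) * q) =
       a * gegen_int h ((f - r) * p) - (a * c) * gegen_int h (p * p)"
      using z by (simp add: gegen_int_diff[OF h] gegen_int_add[OF h] gegen_int_smult)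
    also have "\<dots> = 0" using pp by (simp add: c_def)
    finally show "gegen_int h ((f - (r + smult c p)) * q) = 0" .
  qed
  ultimately show ?case by blast
qed

lemma gegen_orth_at_1:
  assumes h: "h \<ge> 2" and "gegen_orth h (degree p) p" "p \<noteq> 0"
  shows "poly p 1 \<noteq> 0"
proof
  assume "poly p 1 = 0"
  \<comment> \<open>The integral of \<open>p q = (t - 1) q\<^sup>2\<close> would vanish by orthogonality but is negative.\<close>
  then obtain q where q: "p = [:-1, 1:] * q" by (metis poly_eq_0_iff_dvd dvdE)
  with \<open>p \<noteq> 0\<close> have "q \<noteq> 0" by auto
  then have "degree p = Suc (degree q)" unfolding q by (subst degree_mult_eq) auto
  then have "gegen_int h (p * q) = 0" using assms by (simp add: gegen_orth_def)
  moreover have "p * q = smult (-1) ([:1, -1:] * (q * q))" by (simp add: q algebra_simps)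
  moreover have "gegen_int h ([:1, -1:] * (q * q)) > 0"
  proof (rule gegen_int_pos[OF h])
    show "[:1, -1:] * (q * q) \<noteq> 0" using \<open>q \<noteq> 0\<close> by (simp del: mult_pCons_left)
    show "poly ([:1, -1:] * (q * q)) t \<ge> 0" if "t \<le> 1" for t
    proof -
      have "poly ([:1, -1:] * (q * q)) t = (1 - t) * (poly q t * poly q t)"
        by (simp only: poly_mult) simp
      then show ?thesis using that by (auto intro!: mult_nonneg_nonneg)
    qed
  qed
  ultimately show False by (simp add: gegen_int_smult del: smult_minus_left)
qed

text \<open>This makes the description in \<open>gegenbauer_poly\<close> meaningful. The monic
  orthogonal polynomial can be rescaled to the value 1 at 1 because it does not vanish
  there.\<close>

lemma gegenbauer_poly_ex1:
  assumes h: "h \<ge> 2"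
  shows "\<exists>!p. degree p = m \<and> poly p 1 = 1 \<and> gegen_orth h m p"
proof -
  obtain s where s: "s = 0 \<or> degree s < m" "gegen_orth h m (monom 1 m - s)"
    using gegen_projection[OF h] by blast
  define p where "p = monom 1 m - s"
  have c: "coeff p m = 1" using s(1) by (auto simp: p_def coeff_eq_0)
  have "degree p \<le> m"
    unfolding p_def using s(1) by (intro degree_diff_le) (auto simp: degree_monom_le)
  with c have deg: "degree p = m" by (metis le_degree order_antisym zero_neq_one)
  have p1: "poly p 1 \<noteq> 0" 
  proof (rule gegen_orth_at_1[OF h])
    show "gegen_orth h (degree p) p" using s(2) unfolding deg by (simp add: p_def)
    show "p \<noteq> 0" using c by auto
  qed
  define P where "P = smult (1 / poly p 1) p"
  have P: "degree P = m" "poly P 1 = 1" "gegen_orth h m P"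
    using p1 deg s(2) by (auto simp: P_def gegen_orth_def gegen_int_smult p_def[symmetric])
  show ?thesis
  proof (rule ex1I[of _ P])
    fix q assume q: "degree q = m \<and> poly q 1 = 1 \<and> gegen_orth h m q"
    then obtain a where a: "q = smult a P" using gegen_orth_unique[OF h, of P q] P by fastforce
    with q P show "q = P" by auto
  qed (use P in blast)
qed

lemma
  assumes h: "h \<ge> 2"
  shows degree_gegenbauer_poly: "degree (gegenbauer_poly h m) = m"
    and gegenbauer_poly_1: "poly (gegenbauer_poly h m) 1 = 1"
    and gegen_orth_gegenbauer_poly: "gegen_orth h m (gegenbauer_poly h m)"
proof -
  have "gegenbauer_poly h m = (THE p. degree p = m \<and> poly p 1 = 1 \<and> gegen_orth h m p)"
    unfolding gegenbauer_poly_def gegen_orth_def gegen_int_def gegen_weight_def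
    by (simp add: mult.assoc)
  then show "degree (gegenbauer_poly h m) = m" "poly (gegenbauer_poly h m) 1 = 1"
     "gegen_orth h m (gegenbauer_poly h m)"
    using theI'[OF gegenbauer_poly_ex1[OF h, of m]] by auto
qed

subsection \<open>Reflection-invariant measures on spheres\<close>

text \<open>The reflection in the hyperplane orthogonal to \<open>a\<close>. For
  \<open>a = 0\<close> the quotient is 0 and the map is the identity, so invariance can be stated
  for all vectors of a subspace.\<close>

definition hrefl :: "'a::real_inner \<Rightarrow> 'a \<Rightarrow> 'a" where
  "hrefl a x = x - (2 * (x \<bullet> a) / (a \<bullet> a)) *\<^sub>R a"

lemma inner_hrefl_left: "hrefl a x \<bullet> y = x \<bullet> hrefl a y"
  by (simp add: hrefl_def inner_diff_left inner_diff_right inner_commute)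

lemma hrefl_hrefl [simp]: "hrefl a (hrefl a x) = x"
  by (cases "a = 0") (simp_all add: hrefl_def inner_diff_left scaleR_diff_left[symmetric])

lemma norm_hrefl [simp]: "norm (hrefl a x) = norm x"
  by (simp add: norm_eq_sqrt_inner inner_hrefl_left)

lemma linear_hrefl: "linear (hrefl a)"
  by (rule linearI) (simp_all add: hrefl_def inner_add_left add_divide_distrib algebra_simps)

lemma hrefl_orthogonal: "x \<bullet> a = 0 \<Longrightarrow> hrefl a x = x"
  by (simp add: hrefl_def)

lemma hrefl_self: "hrefl a a = - a"
  by (cases "a = 0") (simp_all add: hrefl_def scaleR_left.diff[symmetric] scaleR_2)

text \<open>The mirror is the perpendicular bisector of \<open>e\<close> and \<open>g\<close>.
  Through this lemma invariance under reflections does the work of rotation invariance.\<close>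

lemma hrefl_swap:
  assumes "norm e = norm g"
  shows "hrefl (e - g) e = g"
proof (cases "e = g")
  case False
  have "e \<bullet> e = g \<bullet> g" using assms by (simp add: norm_eq)
  then have "(e - g) \<bullet> (e - g) = 2 * (e \<bullet> (e - g))"
    by (simp add: inner_diff_left inner_diff_right inner_commute)
  moreover have "(e - g) \<bullet> (e - g) \<noteq> 0" using False by simp
  ultimately show ?thesis by (simp add: hrefl_def)
qed (simp add: hrefl_def)

lemma borel_measurable_hrefl [measurable]: "hrefl (a::'a::euclidean_space) \<in> borel_measurable borel"
  by (intro borel_measurable_continuous_onI linear_continuous_on linear_conv_bounded_linear[THEN iffD1] linear_hrefl)

text \<open>An orthonormal basis of the complement \<open>U\<close> of \<open>C\<close> inside
  \<open>V\<close> is added; it spans the rest because a vector minus its projection to the span of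
  \<open>C\<close> lies in \<open>U\<close>.\<close>

lemma extend_orthonormal:
  fixes V :: "'a::euclidean_space set"
  assumes V: "subspace V" and C: "C \<subseteq> V" "pairwise orthogonal C" "\<And>x. x \<in> C \<Longrightarrow> norm x = 1"
  obtains B where "C \<subseteq> B" "B \<subseteq> V" "finite B" "pairwise orthogonal B" "\<forall>x\<in>B. norm x = 1"
    "span B = V" "card B = dim V"
proof -
  have finC: "finite C"
    using C(2) by (rule pairwise_orthogonal_imp_finite)
  define U where "U = {v \<in> V. \<forall>c\<in>C. c \<bullet> v = 0}"
  have "subspace U"
    unfolding U_def using V by (auto simp: subspace_def inner_right_distrib)
  then obtain D where D: "D \<subseteq> U" "pairwise orthogonal D" "\<And>x. x \<in> D \<Longrightarrow> norm x = 1" "span D = U"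
    by (metis orthonormal_basis_subspace)
  define B where "B = C \<union> D"
  have "B \<subseteq> V" using C D by (auto simp: B_def U_def)
  have n1: "norm x = 1" if "x \<in> B" for x using that C D by (auto simp: B_def)
  have CD: "c \<bullet> d = 0" "d \<bullet> c = 0" if "c \<in> C" "d \<in> D" for c d
    using D(1) that by (auto simp: U_def inner_commute[of d c])
  have orth: "pairwise orthogonal B"
    unfolding B_def using C(2) D(2) CD by (auto simp: pairwise_def orthogonal_def)
  have sp: "span B = V"
  proof
    show "span B \<subseteq> V" using \<open>B \<subseteq> V\<close> V by (rule span_minimal)
    show "V \<subseteq> span B"
    proof
      fix v assume v: "v \<in> V"
      define p where "p = (\<Sum>c\<in>C. (v \<bullet> c) *\<^sub>R c)"
      have pC: "p \<in> span C" unfolding p_def by (intro span_sum span_scale span_base)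
      have pV: "p \<in> V" using pC C(1) V by (metis span_minimal subsetD)
      have "v - p \<in> U"
      proof -
        have "c \<bullet> (v - p) = 0" if "c \<in> C" for c
        proof -
          have "c \<bullet> p = (\<Sum>x\<in>C. if x = c then v \<bullet> c else 0)"
            unfolding p_def inner_sum_right
          proof (intro sum.cong refl)
            fix x assume "x \<in> C"
            show "c \<bullet> (v \<bullet> x) *\<^sub>R x = (if x = c then v \<bullet> c else 0)"
            proof (cases "x = c")
              case True
              then show ?thesis using C(3)[OF that] by (simp add: norm_eq_1)
            next
              case False
              then have "c \<bullet> x = 0" using C(2) that \<open>x \<in> C\<close> by (auto simp: pairwise_def orthogonal_def)
              with False show ?thesis by simp
            qed
          qed
          also have "\<dots> = v \<bullet> c" using finC that by simp
          finally show ?thesis by (simp add: inner_diff_right inner_commute)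
        qed
        then show ?thesis using v pV V by (simp add: U_def subspace_diff)
      qed
      then have "v - p \<in> span B" using span_mono[of D B] by (auto simp: D(4) B_def)
      moreover have "p \<in> span B" using pC span_mono[of C B] by (auto simp: B_def)
      ultimately show "v \<in> span B" by (metis diff_add_cancel span_add)
    qed
  qed
  have "0 \<notin> B" using n1 by force
  then have ind: "independent B" using orth pairwise_orthogonal_independent by blast
  have "card B = dim V" using ind sp by (metis dim_eq_card_independent dim_span)
  then show ?thesis using that[of B] \<open>B \<subseteq> V\<close> n1 orth sp independent_imp_finite[OF ind]
    by (auto simp: B_def)
qed

lemma orthonormal_parseval:
  fixes w :: "'a::euclidean_space"
  assumes "finite B" "pairwise orthogonal B" "\<forall>x\<in>B. norm x = 1" "w \<in> span B"
  shows "(\<Sum>b\<in>B. (w \<bullet> b)\<^sup>2) = (norm w)\<^sup>2"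
proof -
  have "(\<Sum>b\<in>B. (w \<bullet> b) *\<^sub>R b) = w"
    using assms by (intro orthonormal_basis_expand) auto
  then have "w \<bullet> w = w \<bullet> (\<Sum>b\<in>B. (w \<bullet> b) *\<^sub>R b)" by simp
  then show ?thesis unfolding power2_norm_eq_inner by (simp add: inner_sum_right power2_eq_square)
qed

section \<open>Integrands bounded on the unit sphere, and Fubini for measures on spheres\<close>

text \<open>An integrability criterion that does not mention the measure: it serves every
  probability measure concentrated on the sphere and is stable under sums and products.\<close>

definition sbounded :: "('a::euclidean_space \<Rightarrow> real) \<Rightarrow> bool" where
  "sbounded f \<longleftrightarrow> f \<in> borel_measurable borel \<and> (\<exists>B. \<forall>x. norm x = 1 \<longrightarrow> \<bar>f x\<bar> \<le> B)"

lemma sbounded_measurable: "sbounded f \<Longrightarrow> f \<in> borel_measurable borel"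
  by (simp add: sbounded_def)

lemma sbounded_const: "sbounded (\<lambda>x. c)"
  by (auto simp: sbounded_def)

lemma sbounded_mult:
  assumes "sbounded f" "sbounded g"
  shows "sbounded (\<lambda>x. f x * g x)"
proof -
  obtain A B where "\<And>x. norm x = 1 \<Longrightarrow> \<bar>f x\<bar> \<le> A" "\<And>x. norm x = 1 \<Longrightarrow> \<bar>g x\<bar> \<le> B"
    using assms by (auto simp: sbounded_def)
  then have "\<bar>f x * g x\<bar> \<le> \<bar>A\<bar> * \<bar>B\<bar>" if "norm x = 1" for x
    unfolding abs_mult by (intro mult_mono) (use that in \<open>auto intro: order_trans[OF _ abs_ge_self]\<close>)
  then show ?thesis using assms by (auto simp: sbounded_def)
qed

lemma sbounded_add:
  assumes "sbounded f" "sbounded g"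
  shows "sbounded (\<lambda>x. f x + g x)"
proof -
  obtain A B where "\<And>x. norm x = 1 \<Longrightarrow> \<bar>f x\<bar> \<le> A" "\<And>x. norm x = 1 \<Longrightarrow> \<bar>g x\<bar> \<le> B"
    using assms by (auto simp: sbounded_def)
  then have "\<bar>f x + g x\<bar> \<le> A + B" if "norm x = 1" for x
    using that by (meson abs_triangle_ineq add_mono order_trans)
  then show ?thesis using assms by (auto simp: sbounded_def)
qed

lemma sbounded_power: "sbounded f \<Longrightarrow> sbounded (\<lambda>x. f x ^ n)"
  by (induction n) (auto intro: sbounded_mult sbounded_const)

lemma sbounded_sum: "(\<And>i. i \<in> I \<Longrightarrow> sbounded (f i)) \<Longrightarrow> sbounded (\<lambda>x. \<Sum>i\<in>I. f i x)"
  by (induction I rule: infinite_finite_induct) (auto intro: sbounded_add sbounded_const)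

lemma sbounded_inner: "sbounded (\<lambda>x. x \<bullet> a)"
proof -
  have "\<bar>x \<bullet> a\<bar> \<le> norm a" if "norm x = 1" for x
    using Cauchy_Schwarz_ineq2[of x a] that by simp
  then show ?thesis by (auto simp: sbounded_def)
qed

lemma sbounded_poly_inner: "sbounded (\<lambda>x. poly p (x \<bullet> a))"
  unfolding poly_altdef by (intro sbounded_sum sbounded_mult sbounded_const sbounded_power sbounded_inner)

lemmas sbounded_intros =
  sbounded_poly_inner sbounded_inner sbounded_power sbounded_mult sbounded_add sbounded_sum sbounded_const

text \<open>Measures on the sphere stay Borel measures on the whole space, so facts about points of
  the sphere enter integrals almost everywhere.\<close>

locale sphere_prob = prob_space M for M :: "'a::euclidean_space measure" +
  assumes sets_M [measurable_cong]: "sets M = sets borel"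
    and AE_norm: "AE x in M. norm x = 1"
begin

lemma space_M [simp]: "space M = UNIV"
  using sets_eq_imp_space_eq[OF sets_M] by simp

lemma sbounded_integrable:
  assumes "sbounded f"
  shows "integrable M f"
proof -
  obtain B where "\<And>x. norm x = 1 \<Longrightarrow> \<bar>f x\<bar> \<le> B" using assms by (auto simp: sbounded_def)
  then have "AE x in M. norm (f x) \<le> B" using AE_norm by auto
  moreover have [measurable]: "f \<in> borel_measurable borel" using assms by (rule sbounded_measurable)
  have "f \<in> borel_measurable M" by measurable
  ultimately show ?thesis by (rule integrable_const_bound)
qed

end

lemma sphere_Fubini:
  fixes k :: "'a::euclidean_space \<Rightarrow> 'b::euclidean_space \<Rightarrow> real"
  assumes "sphere_prob M" "sphere_prob N"
    and [measurable]: "(\<lambda>(x, y). k x y) \<in> borel_measurable (borel \<Otimes>\<^sub>M borel)"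
    and bd: "\<And>x y. norm x = 1 \<Longrightarrow> norm y = 1 \<Longrightarrow> \<bar>k x y\<bar> \<le> B"
  shows "(\<integral>x. (\<integral>y. k x y \<partial>N) \<partial>M) = (\<integral>y. (\<integral>x. k x y \<partial>M) \<partial>N)"
proof -
  interpret M: sphere_prob M by fact
  interpret N: sphere_prob N by fact
  interpret pair_prob_space M N ..
  \<comment> \<open>Cut off outside the two spheres, the kernel is bounded everywhere and hence
    integrable on the product; almost everywhere it is unchanged.\<close>
  define k' where "k' x y = indicator {x. norm x = 1} x * indicator {x. norm x = 1} y * k x y" for x y
  have [measurable]: "{x::'a. norm x = 1} \<in> sets borel" "{x::'b. norm x = 1} \<in> sets borel"
    by measurable
  have meas: "(\<lambda>(x, y). k' x y) \<in> borel_measurable (M \<Otimes>\<^sub>M N)"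
    unfolding k'_def by measurable
  have "\<bar>k' x y\<bar> \<le> \<bar>B\<bar>" for x y
    using bd[of x y] by (auto simp: k'_def indicator_def)
  then have "integrable (M \<Otimes>\<^sub>M N) (\<lambda>(x, y). k' x y)"
    using meas by (intro integrable_const_bound[where B = "\<bar>B\<bar>"]) auto
  then have "(\<integral>y. (\<integral>x. k' x y \<partial>M) \<partial>N) = (\<integral>x. (\<integral>y. k' x y \<partial>N) \<partial>M)"
    by (rule Fubini_integral)
  moreover have "(\<integral>x. (\<integral>y. k' x y \<partial>N) \<partial>M) = (\<integral>x. (\<integral>y. k x y \<partial>N) \<partial>M)"
  proof (intro integral_cong_AE)
    show "AE x in M. (\<integral>y. k' x y \<partial>N) = (\<integral>y. k x y \<partial>N)"
      using M.AE_norm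
    proof eventually_elim
      case (elim x)
      show ?case
        by (intro integral_cong_AE) (use N.AE_norm elim in \<open>auto simp: k'_def\<close>)
    qed
  qed (auto simp: k'_def)
  moreover have "(\<integral>y. (\<integral>x. k' x y \<partial>M) \<partial>N) = (\<integral>y. (\<integral>x. k x y \<partial>M) \<partial>N)"
  proof (intro integral_cong_AE)
    show "AE y in N. (\<integral>x. k' x y \<partial>M) = (\<integral>x. k x y \<partial>M)"
      using N.AE_norm
    proof eventually_elim
      case (elim y)
      show ?case
        by (intro integral_cong_AE) (use M.AE_norm elim in \<open>auto simp: k'_def\<close>)
    qed
  qed (auto simp: k'_def)
  ultimately show ?thesis by simp
qed

section \<open>The law of one coordinate under a reflection-invariant measure\<close>

text \<open>The expectation under the probability density proportional to the weight. It turns out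
  to be the law of one coordinate of a uniform point on the sphere in dimension
  \<open>h\<close>.\<close>

definition gegen_mean :: "nat \<Rightarrow> real poly \<Rightarrow> real" where
  "gegen_mean h p = gegen_int h p / gegen_int h 1"

text \<open>The coefficient of degree 2 is the one wanted; the other two carry its
  induction.\<close>

lemma coeff_1_x2_power:
  "coeff ([:1, 0, 1:] ^ n :: real poly) 0 = 1" "coeff ([:1, 0, 1:] ^ n :: real poly) 1 = 0"
  "coeff ([:1, 0, 1:] ^ n :: real poly) 2 = real n"
proof (induction n)
  case (Suc n)
  { case 1 show ?case using Suc by simp }
  { case 2 show ?case using Suc by simp }
  { case 3 show ?case using Suc by (simp add: numeral_2_eq_2) }
qed auto

text \<open>One locale serves the full sphere, with \<open>V = UNIV\<close>, and the sphere in the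
  hyperplane orthogonal to a unit vector. Uniformity is expressed solely as invariance under
  reflections along vectors of \<open>V\<close>.\<close>

locale invariant_sphere_prob = sphere_prob M for M :: "'a::euclidean_space measure" +
  fixes V :: "'a set" and h :: nat
  assumes V: "subspace V" and dim_V: "dim V = h" and h: "h \<ge> 2"
    and AE_V: "AE x in M. x \<in> V"
    and distr_hrefl: "\<And>a. a \<in> V \<Longrightarrow> distr M borel (hrefl a) = M"
begin

lemma integral_hrefl:
  assumes "f \<in> borel_measurable borel" "a \<in> V"
  shows "(\<integral>w. f (hrefl a w) \<partial>M) = (\<integral>w. (f w :: real) \<partial>M)"
proof -
  have "(\<integral>w. f w \<partial>M) = (\<integral>w. f w \<partial>(distr M borel (hrefl a)))" using distr_hrefl[OF assms(2)] by simp
  also have "\<dots> = (\<integral>w. f (hrefl a w) \<partial>M)"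
    using assms by (intro integral_distr) (auto simp: measurable_cong_sets[OF sets_M refl])
  finally show ?thesis by simp
qed

text \<open>The reflection along \<open>e\<close> changes the sign of the odd power and leaves
  \<open>f\<close> alone.\<close>

lemma integral_odd:
  assumes f: "sbounded f" "\<And>w. f (hrefl e w) = f w" and e: "e \<in> V" and "odd k"
  shows "(\<integral>w. f w * (w \<bullet> e) ^ k \<partial>M) = 0"
proof -
  have "(\<integral>w. f w * (w \<bullet> e) ^ k \<partial>M) = (\<integral>w. f (hrefl e w) * (hrefl e w \<bullet> e) ^ k \<partial>M)"
    by (rule integral_hrefl[symmetric])
       (use e f sbounded_measurable in \<open>auto intro!: borel_measurable_times\<close>)
  also have "\<dots> = (\<integral>w. - (f w * (w \<bullet> e) ^ k) \<partial>M)"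
    using \<open>odd k\<close> by (simp add: f inner_hrefl_left hrefl_self)
  finally show ?thesis by simp
qed

text \<open>The vector e + b g is sqrt(1 + b^2) times a unit vector \<open>u\<close> in the plane of
  \<open>e\<close> and \<open>g\<close>, and the reflection along e - u carries \<open>e\<close> to
  \<open>u\<close>.\<close>

lemma integral_rotate:
  assumes f: "sbounded f" "\<And>a w. a \<in> span {e, g} \<Longrightarrow> f (hrefl a w) = f w"
    and eg: "e \<in> V" "g \<in> V" "norm e = 1" "norm g = 1" "e \<bullet> g = 0"
  shows "(\<integral>w. f w * (w \<bullet> e + b * (w \<bullet> g)) ^ (2 * n) \<partial>M) = (1 + b\<^sup>2) ^ n * (\<integral>w. f w * (w \<bullet> e) ^ (2 * n) \<partial>M)"
proof -
  define r where "r = sqrt (1 + b\<^sup>2)"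
  have r: "r > 0" by (simp add: r_def add_pos_nonneg)
  have r2: "r\<^sup>2 = 1 + b\<^sup>2" by (simp add: r_def)
  define u where "u = (1 / r) *\<^sub>R (e + b *\<^sub>R g)"
  have "(e + b *\<^sub>R g) \<bullet> (e + b *\<^sub>R g) = 1 + b\<^sup>2"
    using eg by (simp add: inner_add_left inner_add_right inner_commute norm_eq_1 power2_eq_square)
  then have "norm (e + b *\<^sub>R g) = r" by (simp add: norm_eq_sqrt_inner r_def)
  then have u1: "norm u = 1" using r by (simp add: u_def)
  define a where "a = e - u"
  have aS: "a \<in> span {e, g}"
    unfolding a_def u_def by (intro span_diff span_scale span_add span_base) auto
  have "span {e, g} \<subseteq> V" using eg V by (intro span_minimal) auto
  then have aV: "a \<in> V" using aS by auto
  have "(\<integral>w. f w * (w \<bullet> e) ^ (2 * n) \<partial>M) = (\<integral>w. f (hrefl a w) * (hrefl a w \<bullet> e) ^ (2 * n) \<partial>M)"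
    by (rule integral_hrefl[symmetric])
       (use aV f sbounded_measurable in \<open>auto intro!: borel_measurable_times\<close>)
  also have "\<dots> = (\<integral>w. f w * (w \<bullet> u) ^ (2 * n) \<partial>M)"
    using f(2)[OF aS] hrefl_swap[of e u] u1 eg by (simp add: inner_hrefl_left a_def)
  finally have "r ^ (2 * n) * (\<integral>w. f w * (w \<bullet> e) ^ (2 * n) \<partial>M)
      = (\<integral>w. r ^ (2 * n) * (f w * (w \<bullet> u) ^ (2 * n)) \<partial>M)" by simp
  also have "\<dots> = (\<integral>w. f w * (w \<bullet> e + b * (w \<bullet> g)) ^ (2 * n) \<partial>M)"
  proof (intro Bochner_Integration.integral_cong refl)
    fix w
    have "r * (w \<bullet> u) = w \<bullet> e + b * (w \<bullet> g)"
      using r by (simp add: u_def inner_add_right field_simps)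
    then show "r ^ (2 * n) * (f w * (w \<bullet> u) ^ (2 * n)) = f w * (w \<bullet> e + b * (w \<bullet> g)) ^ (2 * n)"
      by (metis power_mult_distrib mult.left_commute)
  qed
  finally show ?thesis by (simp add: power_mult r2)
qed

text \<open>Both sides of \<open>integral_rotate\<close> are polynomials in \<open>b\<close>; the coefficients of \<open>b\<^sup>2\<close> are compared.\<close>

lemma integral_two_directions:
  assumes f: "sbounded f" "\<And>a w. a \<in> span {e, g} \<Longrightarrow> f (hrefl a w) = f w"
    and eg: "e \<in> V" "g \<in> V" "norm e = 1" "norm g = 1" "e \<bullet> g = 0"
  shows "real (2 * n + 1) * (\<integral>w. f w * (w \<bullet> e) ^ (2 * n) * (w \<bullet> g)\<^sup>2 \<partial>M)
    = (\<integral>w. f w * (w \<bullet> e) ^ (2 * n + 2) \<partial>M)"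
proof -
  define N where "N = 2 * (n + 1)"
  define I where "I k = (\<integral>w. f w * (w \<bullet> g) ^ k * (w \<bullet> e) ^ (N - k) \<partial>M)" for k
  have "poly (\<Sum>k\<le>N. monom (real (N choose k) * I k) k) b = poly (smult (I 0) ([:1, 0, 1:] ^ (n + 1))) b" for b
  proof -
    have "(\<integral>w. f w * (w \<bullet> e + b * (w \<bullet> g)) ^ N \<partial>M)
        = (\<integral>w. (\<Sum>k\<le>N. real (N choose k) * b ^ k * (f w * (w \<bullet> g) ^ k * (w \<bullet> e) ^ (N - k))) \<partial>M)"
    proof (intro Bochner_Integration.integral_cong refl)
      fix w
      have "(w \<bullet> e + b * (w \<bullet> g)) ^ N = (b * (w \<bullet> g) + w \<bullet> e) ^ N" by (simp add: add.commute)
      also have "\<dots> = (\<Sum>k\<le>N. real (N choose k) * (b * (w \<bullet> g)) ^ k * (w \<bullet> e) ^ (N - k))"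
        by (rule binomial_ring)
      finally show "f w * (w \<bullet> e + b * (w \<bullet> g)) ^ N =
          (\<Sum>k\<le>N. real (N choose k) * b ^ k * (f w * (w \<bullet> g) ^ k * (w \<bullet> e) ^ (N - k)))"
        by (simp add: sum_distrib_left power_mult_distrib mult_ac)
    qed
    also have "\<dots> = (\<Sum>k\<le>N. real (N choose k) * b ^ k * I k)"
      unfolding I_def
      by (subst Bochner_Integration.integral_sum)
         (auto intro!: sbounded_integrable sbounded_intros f)
    finally have "(\<Sum>k\<le>N. real (N choose k) * b ^ k * I k) = (1 + b\<^sup>2) ^ (n + 1) * I 0"
      using integral_rotate[of f e g b "n + 1"] f eg by (simp add: I_def N_def)
    moreover have "poly (smult (I 0) ([:1, 0, 1:] ^ (n + 1))) b = (1 + b\<^sup>2) ^ (n + 1) * I 0"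
      by (simp only: poly_smult poly_power) (simp add: power2_eq_square)
    moreover have "poly (\<Sum>k\<le>N. monom (real (N choose k) * I k) k) b = (\<Sum>k\<le>N. real (N choose k) * b ^ k * I k)"
      by (simp add: poly_sum poly_monom mult_ac)
    ultimately show ?thesis by (simp only:)
  qed
  then have "(\<Sum>k\<le>N. monom (real (N choose k) * I k) k) = smult (I 0) ([:1, 0, 1:] ^ (n + 1))"
    by (subst poly_eq_poly_eq_iff[symmetric]) (rule ext)
  then have "coeff (\<Sum>k\<le>N. monom (real (N choose k) * I k) k) 2 = I 0 * real (n + 1)"
    using coeff_1_x2_power(3)[of "n + 1"] by (simp del: power_Suc)
  moreover have "2 \<le> N" by (simp add: N_def)
  then have "coeff (\<Sum>k\<le>N. monom (real (N choose k) * I k) k) 2 = real (N choose 2) * I 2"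
    by (simp add: coeff_sum)
  \<comment> \<open>On the left \<open>I 2\<close> has the factor (n + 1)(2n + 1), on the right
    \<open>I 0\<close> has the factor n + 1; cancelling n + 1 leaves the constant of the
    claim.\<close>
  moreover have "real (N choose 2) = real (n + 1) * real (2 * n + 1)"
    unfolding N_def by (simp add: choose_two algebra_simps)
  ultimately have "real (2 * n + 1) * I 2 = I 0" by simp
  then show ?thesis by (simp add: I_def N_def mult_ac)
qed

text \<open>This recurrence replaces the explicit density of one coordinate of a uniform point on a sphere:
for an orthonormal basis of \<open>V\<close> it is the moment recurrence of the Gegenbauer weight.\<close>

lemma integral_radial:
  assumes f: "sbounded f" "\<And>a w. a \<in> span B \<Longrightarrow> f (hrefl a w) = f w"
    and B: "finite B" "B \<subseteq> V" "pairwise orthogonal B" "\<And>x. x \<in> B \<Longrightarrow> norm x = 1" and e: "e \<in> B"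
  shows "(2 * real n + real (card B)) * (\<integral>w. f w * (w \<bullet> e) ^ (2 * n + 2) \<partial>M)
    = (2 * real n + 1) * (\<integral>w. f w * (w \<bullet> e) ^ (2 * n) * (\<Sum>g\<in>B. (w \<bullet> g)\<^sup>2) \<partial>M)"
proof -
  let ?J = "\<integral>w. f w * (w \<bullet> e) ^ (2 * n + 2) \<partial>M"
  let ?I = "\<lambda>g. \<integral>w. f w * (w \<bullet> e) ^ (2 * n) * (w \<bullet> g)\<^sup>2 \<partial>M"
  have "(\<integral>w. f w * (w \<bullet> e) ^ (2 * n) * (\<Sum>g\<in>B. (w \<bullet> g)\<^sup>2) \<partial>M)
      = (\<Sum>g\<in>B. ?I g)"
    unfolding sum_distrib_left
    by (intro Bochner_Integration.integral_sum sbounded_integrable sbounded_intros f)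
  also have "\<dots> = ?I e + (\<Sum>g\<in>B - {e}. ?I g)"
    using B(1) e by (rule sum.remove)
  also have "?I e = ?J" by (simp only: power_add mult.assoc)
  also have "(2 * real n + 1) * (?J + (\<Sum>g\<in>B - {e}. ?I g)) = (2 * real n + 1) * ?J +
     (\<Sum>g\<in>B - {e}. real (2 * n + 1) * ?I g)"
    unfolding distrib_left sum_distrib_left by (simp add: add.commute)
  \<comment> \<open>Each direction other than \<open>e\<close> contributes \<open>?J\<close> once
    after multiplication by 2n + 1, and \<open>e\<close> itself contributes it 2n + 1 times; this
    adds up to 2n + \<open>card B\<close>.\<close>
  also have "(\<Sum>g\<in>B - {e}. real (2 * n + 1) * ?I g)
     = (\<Sum>g\<in>B - {e}. ?J)"
  proof (intro sum.cong refl integral_two_directions f)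
    fix g assume g: "g \<in> B - {e}"
    then show "e \<bullet> g = 0" using B(3) e by (auto simp: pairwise_def orthogonal_def)
    show "a \<in> span B" if "a \<in> span {e, g}" for a
      using span_mono[of "{e, g}" B] g e that by auto
  qed (use B e in auto)
  also have "\<dots> = (real (card B) - 1) * ?J"
  proof -
    have "card B \<ge> 1" using B(1) e by (metis One_nat_def Suc_leI card_gt_0_iff empty_iff)
    moreover have "card (B - {e}) = card B - 1" using B(1) e by simp
    ultimately show ?thesis by (simp only: sum_constant of_nat_diff of_nat_1)
  qed
  finally have "(2 * real n + 1) * (\<integral>w. f w * (w \<bullet> e) ^ (2 * n) * (\<Sum>g\<in>B. (w \<bullet> g)\<^sup>2) \<partial>M)
    = (2 * real n + 1) * ?J + (real (card B) - 1) * ?J" .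
  moreover have "(2 * a + 1) * S = (2 * a + 1) * J + (c - 1) * J \<Longrightarrow> (2 * a + c) * J = (2 * a + 1) * S"
    for a c J S :: real
    by (simp add: algebra_simps)
  ultimately show ?thesis by blast
qed

lemma AE_parseval:
  assumes "finite B" "pairwise orthogonal B" "\<forall>x\<in>B. norm x = 1" "span B = V"
  shows "AE w in M. (\<Sum>b\<in>B. (w \<bullet> b)\<^sup>2) = 1"
  using AE_V AE_norm
proof eventually_elim
  case (elim w)
  then show ?case using orthonormal_parseval[OF assms(1-3), of w] assms(4) by simp
qed

lemma gegen_int_1_pos: "gegen_int h 1 > 0"
  by (intro gegen_int_pos h) auto

text \<open>Both sides start at 1 and satisfy (2j + h) M(2j + 2) = (2j + 1) M(2j): the left one by
  \<open>integral_radial\<close> over an orthonormal basis of \<open>V\<close>, where the sum of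
  squares is 1 almost everywhere, the right one by integration by parts. Odd moments vanish on both
  sides.\<close>

lemma integral_moment:
  assumes e: "e \<in> V" "norm e = 1"
  shows "(\<integral>w. (w \<bullet> e) ^ k \<partial>M) = gegen_mean h (monom 1 k)"
proof (cases "even k")
  case False
  then obtain j where "k = 2 * j + 1" by (auto elim: oddE)
  then show ?thesis
    using integral_odd[of "\<lambda>_. 1" e k] e False gegen_int_odd[OF h, of j]
    by (simp add: gegen_mean_def sbounded_const)
next
  case True
  then obtain j where k: "k = 2 * j" by (auto elim: evenE)
  have "(\<integral>w. (w \<bullet> e) ^ (2 * j) \<partial>M) = gegen_mean h (monom 1 (2 * j))"
  proof (induction j)
    case 0
    show ?case using gegen_int_1_pos by (simp add: gegen_mean_def prob_space[unfolded space_M])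
  next
    case (Suc j)
    have "{e} \<subseteq> V" "pairwise orthogonal {e}" "\<And>z. z \<in> {e} \<Longrightarrow> norm z = 1" using e by auto
    then obtain B where B: "{e} \<subseteq> B" "B \<subseteq> V" "finite B" "pairwise orthogonal B"
      "\<forall>x\<in>B. norm x = 1" "span B = V" "card B = dim V"
      by (rule extend_orthonormal[OF V])
    have "(2 * real j + real h) * (\<integral>w. (w \<bullet> e) ^ (2 * j + 2) \<partial>M)
       = (2 * real j + 1) * (\<integral>w. (w \<bullet> e) ^ (2 * j) * (\<Sum>g\<in>B. (w \<bullet> g)\<^sup>2) \<partial>M)"
      using integral_radial[of "\<lambda>_. 1" B e j] B dim_V by (simp add: sbounded_const)
    also have "(\<integral>w. (w \<bullet> e) ^ (2 * j) * (\<Sum>g\<in>B. (w \<bullet> g)\<^sup>2) \<partial>M) = (\<integral>w. (w \<bullet> e) ^ (2 * j) \<partial>M)"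
      by (intro integral_cong_AE) (use AE_parseval[OF B(3-6)] in auto)
    also have "\<dots> = gegen_mean h (monom 1 (2 * j))" by (rule Suc)
    also have "(2 * real j + 1) * \<dots> = (2 * real j + real h) * gegen_mean h (monom 1 (2 * j + 2))"
      using gegen_int_even[OF h, of "2 * j"] by (simp add: gegen_mean_def divide_simps)
    finally show ?case using h by simp
  qed
  then show ?thesis using k by simp
qed

lemma integral_poly_inner:
  assumes e: "e \<in> V" "norm e = 1"
  shows "(\<integral>w. poly p (w \<bullet> e) \<partial>M) = gegen_mean h p"
proof -
  have "(\<integral>w. poly p (w \<bullet> e) \<partial>M) = (\<Sum>i\<le>degree p. \<integral>w. coeff p i * (w \<bullet> e) ^ i \<partial>M)"
    unfolding poly_altdef by (intro Bochner_Integration.integral_sum sbounded_integrable sbounded_intros)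
  also have "\<dots> = (\<Sum>i\<le>degree p. coeff p i * gegen_mean h (monom 1 i))"
    using e by (simp add: integral_moment)
  also have "\<dots> = gegen_mean h p"
    unfolding gegen_mean_def gegen_int_poly[OF h, of p] by (simp add: sum_divide_distrib)
  finally show ?thesis .
qed

end

text \<open>The constants with \<open>E[f(t) s^(2 n)] = kappa * E[f(t) (1 - t^2)^n]\<close>, where \<open>t\<close>, \<open>s\<close> are two
orthogonal coordinates of a uniform point of the sphere in dimension \<open>h\<close>.\<close>

fun cond_moment :: "nat \<Rightarrow> nat \<Rightarrow> real" where
  "cond_moment h 0 = 1"
| "cond_moment h (Suc n) = (2 * real n + 1) / (2 * real n + real h - 1) * cond_moment h n"

context invariant_sphere_prob
begin

text \<open>Heuristically, given t = w.x the rest of w is sqrt(1 - t^2) times a uniform point of a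
  sphere in dimension h - 1, whose even coordinate moments are \<open>cond_moment h\<close>. The
  induction applies \<open>integral_radial\<close> to a basis without \<open>x\<close>: its sum of
  squares is 1 - t^2, and this factor is absorbed into \<open>f\<close>.\<close>

lemma integral_poly_inner_even:
  assumes e: "x \<in> V" "norm x = 1" "y \<in> V" "norm y = 1" "x \<bullet> y = 0"
  shows "(\<integral>w. poly f (w \<bullet> x) * (w \<bullet> y) ^ (2 * n) \<partial>M)
    = cond_moment h n * gegen_mean h (f * [:1, 0, -1:] ^ n)"
proof (induction n arbitrary: f)
  case 0
  then show ?case using integral_poly_inner[OF e(1,2)] by simp
next
  case (Suc n)
  have "x \<noteq> y" using e by (auto simp: norm_eq_1)
  have "{x, y} \<subseteq> V" "pairwise orthogonal {x, y}" "\<And>z. z \<in> {x, y} \<Longrightarrow> norm z = 1"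
    using e by (auto simp: pairwise_insert orthogonal_def inner_commute)
  then obtain B where B: "{x, y} \<subseteq> B" "B \<subseteq> V" "finite B" "pairwise orthogonal B"
      "\<forall>x\<in>B. norm x = 1" "span B = V" "card B = dim V"
    by (rule extend_orthonormal[OF V])
  have AE_B: "AE w in M. (\<Sum>b\<in>B. (w \<bullet> b)\<^sup>2) = 1"
    using B by (intro AE_parseval) auto
  define C where "C = B - {x}"
  have cC: "real (card C) = real h - 1"
    using B dim_V h by (simp add: C_def of_nat_diff)
  have xo: "x \<bullet> a = 0" if "a \<in> span C" for a
  proof -
    have "C \<subseteq> {a. x \<bullet> a = 0}" using B(1,4) by (auto simp: C_def pairwise_def orthogonal_def)
    then have "span C \<subseteq> {a. x \<bullet> a = 0}" by (intro span_minimal subspace_hyperplane)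
    with that show ?thesis by auto
  qed
  have inv: "poly f (hrefl a w \<bullet> x) = poly f (w \<bullet> x)" if "a \<in> span C" for a w
    using xo[OF that] by (simp add: inner_hrefl_left hrefl_orthogonal)
  have "(2 * real n + real (card C)) * (\<integral>w. poly f (w \<bullet> x) * (w \<bullet> y) ^ (2 * n + 2) \<partial>M)
    = (2 * real n + 1) * (\<integral>w. poly f (w \<bullet> x) * (w \<bullet> y) ^ (2 * n) * (\<Sum>g\<in>C. (w \<bullet> g)\<^sup>2) \<partial>M)"
    by (rule integral_radial)
       (use B \<open>x \<noteq> y\<close> inv in \<open>auto simp: C_def pairwise_def intro: sbounded_intros\<close>)
  also have "(\<integral>w. poly f (w \<bullet> x) * (w \<bullet> y) ^ (2 * n) * (\<Sum>g\<in>C. (w \<bullet> g)\<^sup>2) \<partial>M)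
    = (\<integral>w. poly (f * [:1, 0, -1:]) (w \<bullet> x) * (w \<bullet> y) ^ (2 * n) \<partial>M)"
  proof (rule integral_cong_AE)
    show "AE w in M. poly f (w \<bullet> x) * (w \<bullet> y) ^ (2 * n) * (\<Sum>g\<in>C. (w \<bullet> g)\<^sup>2)
       = poly (f * [:1, 0, -1:]) (w \<bullet> x) * (w \<bullet> y) ^ (2 * n)"
      using AE_B
    proof eventually_elim
      case (elim w)
      then have "(\<Sum>g\<in>C. (w \<bullet> g)\<^sup>2) = 1 - (w \<bullet> x)\<^sup>2"
        using B(1,3) by (subst (asm) sum.remove[of B x]) (auto simp: C_def)
      moreover have "poly (f * [:1, 0, -1:]) (w \<bullet> x) = poly f (w \<bullet> x) * (1 - (w \<bullet> x)\<^sup>2)"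
        by (simp add: power2_eq_square algebra_simps)
      ultimately show ?case by (simp only: mult_ac)
    qed
  qed measurable
  also have "\<dots> = cond_moment h n * gegen_mean h (f * [:1, 0, -1:] ^ Suc n)"
    by (subst Suc) (simp only: power_Suc mult.assoc)
  finally have eq: "(2 * real n + real h - 1) * (\<integral>w. poly f (w \<bullet> x) * (w \<bullet> y) ^ (2 * n + 2) \<partial>M)
     = (2 * real n + 1) * (cond_moment h n * gegen_mean h (f * [:1, 0, -1:] ^ Suc n))"
    by (simp only: cC add_diff_eq)
  have "2 * real n + real h - 1 > 0" using h by simp
  then show ?case using eq by (simp del: power_Suc mult_pCons_right add: field_simps)
qed

section \<open>Convolution of polynomial kernels on the sphere\<close>

lemma exists_orthonormal_decomposition:
  assumes xy: "x \<in> V" "norm x = 1" "y \<in> V" "norm y = 1"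
  obtains z where "z \<in> V" "norm z = 1" "x \<bullet> z = 0" "y = (x \<bullet> y) *\<^sub>R x + sqrt (1 - (x \<bullet> y)\<^sup>2) *\<^sub>R z"
proof -
  define u where "u = y - (x \<bullet> y) *\<^sub>R x"
  have uV: "u \<in> V" unfolding u_def using V xy by (simp add: subspace_diff subspace_scale)
  have xu: "x \<bullet> u = 0" using xy by (simp add: u_def inner_diff_right norm_eq_1)
  have "u \<bullet> u = 1 - (x \<bullet> y)\<^sup>2"
    using xy by (simp add: u_def inner_diff_right inner_diff_left norm_eq_1 inner_commute power2_eq_square)
  then have nu: "norm u = sqrt (1 - (x \<bullet> y)\<^sup>2)" by (simp add: norm_eq_sqrt_inner)
  show ?thesis
  proof (cases "u = 0")
    case False
    show ?thesis
      by (rule that[of "u /\<^sub>R norm u"])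
         (use False uV xu V in \<open>auto simp: subspace_scale nu[symmetric] u_def\<close>)
  next
    \<comment> \<open>Here \<open>y\<close> is \<open>x\<close> or its negative and the square root
      is 0, so any unit vector of \<open>V\<close> orthogonal to \<open>x\<close> will do; one
      exists because \<open>V\<close> has dimension at least 2.\<close>
    case True
    have "{x} \<subseteq> V" "pairwise orthogonal {x}" "\<And>z. z \<in> {x} \<Longrightarrow> norm z = 1" using xy by auto
    then obtain B where B: "{x} \<subseteq> B" "B \<subseteq> V" "finite B" "pairwise orthogonal B"
      "\<forall>x\<in>B. norm x = 1" "span B = V" "card B = dim V"
      by (rule extend_orthonormal[OF V])
    have "card B \<ge> 2" using B dim_V h by simp
    then have "B \<noteq> {x}" by auto
    then obtain z where "z \<in> B" "z \<noteq> x" using B(1) by blast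
    then show ?thesis
      using that[of z] B True nu by (auto simp: pairwise_def orthogonal_def u_def)
  qed
qed

text \<open>Expand (w.y)^k binomially along y = s x + c z with z orthogonal to x. Odd powers of w.z
  integrate to 0. For even j the moment of w.z brings in a power of 1 - (w.x)^2, and c^j is the same
  power of 1 - s^2. So one polynomial of degree at most k occurs twice: paired with
  \<open>f\<close>, and evaluated at x.y. The first occurrence yields orthogonality, the second a
  degree bound.\<close>

lemma integral_poly_inner_power:
  assumes xy: "x \<in> V" "norm x = 1" "y \<in> V" "norm y = 1"
  shows "(\<integral>w. poly f (w \<bullet> x) * (w \<bullet> y) ^ k \<partial>M) =
    (\<Sum>j | j \<le> k \<and> even j. real (k choose j) * cond_moment h (j div 2)
        * gegen_mean h (f * (monom 1 (k - j) * [:1, 0, -1:] ^ (j div 2)))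
        * poly (monom 1 (k - j) * [:1, 0, -1:] ^ (j div 2)) (x \<bullet> y))"
proof -
  define s c where "s = x \<bullet> y" and "c = sqrt (1 - s\<^sup>2)"
  obtain z where z: "z \<in> V" "norm z = 1" "x \<bullet> z = 0" "y = s *\<^sub>R x + c *\<^sub>R z"
    unfolding s_def c_def by (rule exists_orthonormal_decomposition[OF xy])
  have "\<bar>s\<bar> \<le> 1" using Cauchy_Schwarz_ineq2[of x y] xy by (simp add: s_def)
  then have c2: "c\<^sup>2 = 1 - s\<^sup>2" by (simp add: c_def abs_square_le_1)
  let ?t = "\<lambda>j. \<integral>w. poly (f * monom 1 (k - j)) (w \<bullet> x) * (w \<bullet> z) ^ j \<partial>M"
  have "(\<integral>w. poly f (w \<bullet> x) * (w \<bullet> y) ^ k \<partial>M) =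
     (\<integral>w. (\<Sum>j\<le>k. real (k choose j) * c ^ j * s ^ (k - j) *
        (poly (f * monom 1 (k - j)) (w \<bullet> x) * (w \<bullet> z) ^ j)) \<partial>M)"
  proof (intro Bochner_Integration.integral_cong refl)
    fix w
    have "(w \<bullet> y) ^ k = (c * (w \<bullet> z) + s * (w \<bullet> x)) ^ k"
      by (subst z(4)) (simp add: inner_add_right add.commute)
    then have "(w \<bullet> y) ^ k = (\<Sum>j\<le>k. real (k choose j) * (c * (w \<bullet> z)) ^ j * (s * (w \<bullet> x)) ^ (k - j))"
      by (simp only: binomial_ring)
    then show "poly f (w \<bullet> x) * (w \<bullet> y) ^ k = (\<Sum>j\<le>k. real (k choose j) * c ^ j * s ^ (k - j) *
        (poly (f * monom 1 (k - j)) (w \<bullet> x) * (w \<bullet> z) ^ j))"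
      by (simp add: sum_distrib_left power_mult_distrib poly_monom mult_ac)
  qed
  also have "\<dots> = (\<Sum>j\<le>k. real (k choose j) * c ^ j * s ^ (k - j) * ?t j)"
    by (subst Bochner_Integration.integral_sum)
       (intro sbounded_integrable sbounded_intros, simp)
  also have "\<dots> = (\<Sum>j | j \<le> k \<and> even j. real (k choose j) * c ^ j * s ^ (k - j) * ?t j)"
  proof (rule sum.mono_neutral_right)
    show "\<forall>j\<in>{..k} - {j. j \<le> k \<and> even j}. real (k choose j) * c ^ j * s ^ (k - j) * ?t j = 0"
    proof
      fix j assume "j \<in> {..k} - {j. j \<le> k \<and> even j}"
      then have "odd j" by auto
      then have "?t j = 0"
        by (intro integral_odd)
           (use z in \<open>auto intro: sbounded_intros simp: inner_hrefl_left hrefl_orthogonal\<close>)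
      then show "real (k choose j) * c ^ j * s ^ (k - j) * ?t j = 0" by simp
    qed
  qed auto
  also have "\<dots> = (\<Sum>j | j \<le> k \<and> even j. real (k choose j) * cond_moment h (j div 2)
        * gegen_mean h (f * (monom 1 (k - j) * [:1, 0, -1:] ^ (j div 2)))
        * poly (monom 1 (k - j) * [:1, 0, -1:] ^ (j div 2)) (x \<bullet> y))"
  proof (intro sum.cong refl)
    fix j assume "j \<in> {j. j \<le> k \<and> even j}"
    then obtain i where j: "j = 2 * i" by (auto elim: evenE)
    have "c ^ j = (1 - s\<^sup>2) ^ i" unfolding j power_mult c2 ..
    also have "\<dots> = poly ([:1, 0, -1:] ^ (j div 2)) s"
      by (simp add: j power2_eq_square algebra_simps)
    finally have c: "c ^ j = poly ([:1, 0, -1:] ^ (j div 2)) s" .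
    have t: "?t j = cond_moment h (j div 2) * gegen_mean h (f * (monom 1 (k - j) * [:1, 0, -1:] ^ (j div 2)))"
      using integral_poly_inner_even[OF xy(1,2) z(1-3), of "f * monom 1 (k - j)" i]
      by (simp add: j mult.assoc)
    have s: "poly (monom 1 (k - j) * [:1, 0, -1:] ^ (j div 2)) (x \<bullet> y)
        = s ^ (k - j) * poly ([:1, 0, -1:] ^ (j div 2)) s"
      by (simp only: poly_mult poly_monom s_def mult_1)
    show "real (k choose j) * c ^ j * s ^ (k - j) * ?t j =
      real (k choose j) * cond_moment h (j div 2)
        * gegen_mean h (f * (monom 1 (k - j) * [:1, 0, -1:] ^ (j div 2)))
        * poly (monom 1 (k - j) * [:1, 0, -1:] ^ (j div 2)) (x \<bullet> y)"
      unfolding c t s by (simp only: mult_ac)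
  qed
  finally show ?thesis .
qed

lemma degree_power_1_x2: "degree ([:1, 0, -1:] ^ n :: real poly) \<le> 2 * n"
  using degree_power_le[of "[:1, 0, -1:] :: real poly" n] by simp

lemma degree_monom_mult_power:
  assumes "even j" "j \<le> k"
  shows "degree (monom 1 (k - j) * [:1, 0, -1:] ^ (j div 2) :: real poly) \<le> k"
proof -
  have "degree (monom 1 (k - j) * [:1, 0, -1:] ^ (j div 2) :: real poly) \<le> (k - j) + 2 * (j div 2)"
    by (rule order_trans[OF degree_mult_le add_mono[OF degree_monom_le degree_power_1_x2]])
  then show ?thesis using assms by simp
qed

text \<open>Every term of the expansion pairs \<open>f\<close> with a polynomial of degree at most
  \<open>degree r\<close>, which is below m.\<close>

lemma integral_orth_poly:
  assumes xy: "x \<in> V" "norm x = 1" "y \<in> V" "norm y = 1"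
    and f: "gegen_orth h m f" and r: "degree r < m"
  shows "(\<integral>w. poly f (w \<bullet> x) * poly r (w \<bullet> y) \<partial>M) = 0"
proof -
  have "(\<integral>w. poly f (w \<bullet> x) * poly r (w \<bullet> y) \<partial>M)
      = (\<integral>w. (\<Sum>k\<le>degree r. coeff r k * (poly f (w \<bullet> x) * (w \<bullet> y) ^ k)) \<partial>M)"
    by (intro Bochner_Integration.integral_cong refl)
       (simp add: poly_altdef[of r] sum_distrib_left mult_ac)
  also have "\<dots> = (\<Sum>k\<le>degree r. coeff r k * (\<integral>w. poly f (w \<bullet> x) * (w \<bullet> y) ^ k \<partial>M))"
    by (subst Bochner_Integration.integral_sum)
       (intro sbounded_integrable sbounded_intros, simp)
  also have "\<dots> = 0"
  proof (intro sum.neutral ballI)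
    fix k assume k: "k \<in> {..degree r}"
    have "gegen_mean h (f * (monom 1 (k - j) * [:1, 0, -1:] ^ (j div 2))) = 0" if "even j" "j \<le> k" for j
      using degree_monom_mult_power[OF that] k r f by (auto simp: gegen_orth_def gegen_mean_def)
    then show "coeff r k * (\<integral>w. poly f (w \<bullet> x) * (w \<bullet> y) ^ k \<partial>M) = 0"
      unfolding integral_poly_inner_power[OF xy] by simp
  qed
  finally show ?thesis .
qed

text \<open>The same expansion, now read as a polynomial in x.y.\<close>

lemma convolution_polynomial:
  "\<exists>g. degree g \<le> degree r \<and> (\<forall>x y. x \<in> V \<longrightarrow> norm x = 1 \<longrightarrow> y \<in> V \<longrightarrow> norm y = 1 \<longrightarrow>
      (\<integral>w. poly f (w \<bullet> x) * poly r (w \<bullet> y) \<partial>M) = poly g (x \<bullet> y))"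
proof -
  define q where "q k j = (monom 1 (k - j) * [:1, 0, -1:] ^ (j div 2) :: real poly)" for k j
  define a where "a k j = real (k choose j) * cond_moment h (j div 2) * gegen_mean h (f * q k j)" for k j
  define g where "g = (\<Sum>k\<le>degree r. smult (coeff r k) (\<Sum>j | j \<le> k \<and> even j. smult (a k j) (q k j)))"
  show ?thesis
  proof (intro exI[of _ g] conjI allI impI)
    show "degree g \<le> degree r"
      unfolding g_def
    proof (rule degree_sum_le[OF finite_atMost order_trans[OF degree_smult_le]])
      fix k assume "k \<in> {..degree r}"
      then have "k \<le> degree r" by simp
      moreover have "degree (\<Sum>j | j \<le> k \<and> even j. smult (a k j) (q k j)) \<le> k"
        by (intro degree_sum_le order_trans[OF degree_smult_le])
           (use degree_monom_mult_power in \<open>auto simp: q_def\<close>)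
      ultimately show "degree (\<Sum>j | j \<le> k \<and> even j. smult (a k j) (q k j)) \<le> degree r" by simp
    qed
  next
    fix x y assume xy: "x \<in> V" "norm x = 1" "y \<in> V" "norm y = 1"
    have "(\<integral>w. poly f (w \<bullet> x) * poly r (w \<bullet> y) \<partial>M)
        = (\<integral>w. (\<Sum>k\<le>degree r. coeff r k * (poly f (w \<bullet> x) * (w \<bullet> y) ^ k)) \<partial>M)"
      by (intro Bochner_Integration.integral_cong refl)
         (simp add: poly_altdef[of r] sum_distrib_left mult_ac)
    also have "\<dots> = (\<Sum>k\<le>degree r. coeff r k * (\<integral>w. poly f (w \<bullet> x) * (w \<bullet> y) ^ k \<partial>M))"
      by (subst Bochner_Integration.integral_sum)
         (intro sbounded_integrable sbounded_intros, simp)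
    also have "\<dots> = poly g (x \<bullet> y)"
      unfolding integral_poly_inner_power[OF xy] g_def a_def q_def poly_sum poly_smult by simp
    finally show "(\<integral>w. poly f (w \<bullet> x) * poly r (w \<bullet> y) \<partial>M) = poly g (x \<bullet> y)" .
  qed
qed

lemma exists_unit: obtains y where "y \<in> V" "norm y = 1"
proof -
  obtain B where B: "B \<subseteq> V" "\<And>x. x \<in> B \<Longrightarrow> norm x = 1" "card B = dim V"
    using V by (metis orthonormal_basis_subspace)
  then have "B \<noteq> {}" using dim_V h by auto
  then show ?thesis using that B by blast
qed

lemma gegenbauer_convolution:
  obtains c where "c > 0"
    "\<And>x y. x \<in> V \<Longrightarrow> norm x = 1 \<Longrightarrow> y \<in> V \<Longrightarrow> norm y = 1 \<Longrightarrow>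
      (\<integral>w. gegenbauer h m (w \<bullet> x) * gegenbauer h m (w \<bullet> y) \<partial>M) = c * gegenbauer h m (x \<bullet> y)"
proof -
  let ?P = "gegenbauer_poly h m"
  have sp: "sphere_prob M" ..
  note P = degree_gegenbauer_poly[OF h, of m] gegenbauer_poly_1[OF h, of m] gegen_orth_gegenbauer_poly[OF h, of m]
  obtain g where g: "degree g \<le> m"
    "\<And>x y. x \<in> V \<Longrightarrow> norm x = 1 \<Longrightarrow> y \<in> V \<Longrightarrow> norm y = 1 \<Longrightarrow>
      (\<integral>w. poly ?P (w \<bullet> x) * poly ?P (w \<bullet> y) \<partial>M) = poly g (x \<bullet> y)"
    using convolution_polynomial[of ?P ?P] unfolding P(1) by blast
  obtain y where y: "y \<in> V" "norm y = 1" by (rule exists_unit)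
  obtain B where B: "B \<ge> 0" "\<And>t. -1 \<le> t \<Longrightarrow> t \<le> 1 \<Longrightarrow> \<bar>poly ?P t\<bar> \<le> B"
    using poly_bounded_on_unit[of ?P] by blast
  \<comment> \<open>\<open>g\<close> inherits orthogonality from \<open>?P\<close> by Fubini, hence is a multiple of \<open>?P\<close>.\<close>
  have "gegen_orth h m g"
    unfolding gegen_orth_def
  proof (intro allI impI)
    fix r :: "real poly" assume r: "degree r < m"
    obtain R where R: "R \<ge> 0" "\<And>t. -1 \<le> t \<Longrightarrow> t \<le> 1 \<Longrightarrow> \<bar>poly r t\<bar> \<le> R"
      using poly_bounded_on_unit[of r] by blast
    \<comment> \<open>A fixed unit vector \<open>y\<close> turns the one-dimensional pairing of
      \<open>g\<close> and \<open>r\<close> into an integral over the sphere, where the definition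
      of \<open>g\<close> as a convolution can be inserted.\<close>
    have "gegen_mean h (g * r) = (\<integral>x. poly g (x \<bullet> y) * poly r (x \<bullet> y) \<partial>M)"
      using integral_poly_inner[OF y, of "g * r"] by simp
    also have "\<dots> = (\<integral>x. (\<integral>w. poly ?P (w \<bullet> x) * poly ?P (w \<bullet> y) * poly r (x \<bullet> y) \<partial>M) \<partial>M)"
    proof (intro integral_cong_AE)
      show "AE x in M. poly g (x \<bullet> y) * poly r (x \<bullet> y) =
          (\<integral>w. poly ?P (w \<bullet> x) * poly ?P (w \<bullet> y) * poly r (x \<bullet> y) \<partial>M)"
        using AE_norm AE_V by eventually_elim (simp add: g(2)[symmetric] y)
    qed measurable
    also have "\<dots> = (\<integral>w. (\<integral>x. poly ?P (w \<bullet> x) * poly ?P (w \<bullet> y) * poly r (x \<bullet> y) \<partial>M) \<partial>M)"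
    proof (rule sphere_Fubini[OF sp sp, where B = "B * B * R"])
      fix x w :: 'a assume "norm x = 1" "norm w = 1"
      then have "\<bar>w \<bullet> x\<bar> \<le> 1" "\<bar>w \<bullet> y\<bar> \<le> 1" "\<bar>x \<bullet> y\<bar> \<le> 1"
        using Cauchy_Schwarz_ineq2[of w x] Cauchy_Schwarz_ineq2[of w y] Cauchy_Schwarz_ineq2[of x y] y by auto
      then show "\<bar>poly ?P (w \<bullet> x) * poly ?P (w \<bullet> y) * poly r (x \<bullet> y)\<bar> \<le> B * B * R"
        unfolding abs_mult by (intro mult_mono B R mult_nonneg_nonneg) (auto simp: abs_le_iff)
    qed measurable
    also have "\<dots> = (\<integral>w. 0 \<partial>M)"
    proof (intro integral_cong_AE)
      show "AE w in M. (\<integral>x. poly ?P (w \<bullet> x) * poly ?P (w \<bullet> y) * poly r (x \<bullet> y) \<partial>M) = 0"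
        using AE_norm AE_V
      proof eventually_elim
        case (elim w)
        have "(\<integral>x. poly ?P (x \<bullet> w) * poly r (x \<bullet> y) \<partial>M) = 0"
          by (rule integral_orth_poly[OF _ _ y P(3) r]) (use elim in auto)
        then have "(\<integral>x. poly ?P (w \<bullet> y) * (poly ?P (x \<bullet> w) * poly r (x \<bullet> y)) \<partial>M) = 0" by simp
        then show ?case by (simp add: inner_commute mult_ac)
      qed
    qed measurable
    finally show "gegen_int h (g * r) = 0"
      using gegen_int_1_pos by (simp add: gegen_mean_def)
  qed
  moreover have "?P \<noteq> 0" using P(2) by auto
  ultimately obtain c where c: "g = smult c ?P"
    using gegen_orth_unique[OF h, of ?P g] P g(1) by auto
  \<comment> \<open>At x = y the kernel has the value 1, which identifies \<open>c\<close> as the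
    mean of the square of \<open>?P\<close>.\<close>
  have "0 < gegen_mean h (?P * ?P)"
    unfolding gegen_mean_def
    by (intro divide_pos_pos gegen_int_1_pos gegen_int_pos h) (use \<open>?P \<noteq> 0\<close> in auto)
  also have "gegen_mean h (?P * ?P) = c * poly ?P (y \<bullet> y)"
    using integral_poly_inner[OF y, of "?P * ?P"] g(2)[OF y y] c by simp
  also have "\<dots> = c" using y P(2) by (simp add: norm_eq_1)
  finally show ?thesis using that[of c] g(2) c by (simp add: gegenbauer_def)
qed

end

subsection \<open>Spheres in hyperplanes\<close>

lemma nn_integral_lborel_translate:
  fixes f :: "'a::euclidean_space \<Rightarrow> ennreal"
  assumes [measurable]: "f \<in> borel_measurable borel"
  shows "(\<integral>\<^sup>+x. f (c + x) \<partial>lborel) = (\<integral>\<^sup>+x. f x \<partial>lborel)"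
proof -
  have "(\<integral>\<^sup>+x. f x \<partial>lborel) = (\<integral>\<^sup>+x. f x \<partial>(distr lborel borel ((+) c)))"
    by (simp add: lborel_distr_plus)
  also have "\<dots> = (\<integral>\<^sup>+x. f (c + x) \<partial>lborel)"
    by (rule nn_integral_distr) auto
  finally show ?thesis by simp
qed

text \<open>As in the uniqueness proof for Haar measure, integrating \<open>1\<^sub>A (T x) 1\<^sub>B (y - T x)\<close> over \<open>x\<close>
and \<open>y\<close> in both orders compares the image measure with \<open>lborel\<close>; the unit ball \<open>B\<close> is invariant
under \<open>T\<close>, so the proportionality factor is 1.\<close>

lemma lborel_distr_hrefl: "distr lborel borel (hrefl a) = (lborel :: 'a::euclidean_space measure)"
proof (rule measure_eqI)
  let ?T = "hrefl a" and ?B = "ball (0::'a) 1"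
  fix A :: "'a set" assume "A \<in> sets (distr lborel borel ?T)"
  then have [measurable]: "A \<in> sets borel" by simp
  have [measurable]: "?B \<in> sets borel" by simp
  define c where "c = emeasure lborel ?B"
  have c: "c \<noteq> 0" "c \<noteq> \<infinity>"
    unfolding c_def using content_ball_pos[of 1 "0::'a"] emeasure_lborel_ball_finite[of "0::'a" 1]
    by (auto simp: measure_def less_top[symmetric])
  have T_add: "?T (x + y) = ?T x + ?T y" for x y by (rule linear_add[OF linear_hrefl])
  interpret lborel_pair: pair_sigma_finite "lborel :: 'a measure" "lborel :: 'a measure" ..
  have "c * emeasure lborel (?T -` A) = c * (\<integral>\<^sup>+x. indicator A (?T x) \<partial>lborel)"
    by (subst nn_integral_indicator[symmetric]) (auto simp: indicator_def[abs_def] vimage_def measurable_sets_borel)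
  also have "\<dots> = (\<integral>\<^sup>+x. indicator A (?T x) * c \<partial>lborel)"
    by (subst nn_integral_multc) (auto simp: mult.commute)
  also have "\<dots> = (\<integral>\<^sup>+x. (\<integral>\<^sup>+y. indicator A (?T x) * indicator ?B (y - ?T x) \<partial>lborel) \<partial>lborel)"
  proof (intro nn_integral_cong)
    fix x :: 'a
    have "(\<integral>\<^sup>+y. indicator ?B (y - ?T x) \<partial>lborel) = (\<integral>\<^sup>+y. indicator ?B y \<partial>lborel)"
      using nn_integral_lborel_translate[of "indicator ?B" "- ?T x"] by simp
    then show "indicator A (?T x) * c = (\<integral>\<^sup>+y. indicator A (?T x) * indicator ?B (y - ?T x) \<partial>lborel)"
      by (subst nn_integral_cmult) (auto simp: c_def)
  qed
  also have "\<dots> = (\<integral>\<^sup>+y. (\<integral>\<^sup>+x. indicator A (?T x) * indicator ?B (y - ?T x) \<partial>lborel) \<partial>lborel)"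
    by (rule lborel_pair.Fubini') measurable
  also have "\<dots> = (\<integral>\<^sup>+y. (\<integral>\<^sup>+x. indicator A (?T x + y) * indicator ?B (- ?T x) \<partial>lborel) \<partial>lborel)"
  proof (rule nn_integral_cong)
    fix y :: 'a
    \<comment> \<open>Translating \<open>x\<close> by \<open>?T y\<close> replaces
      \<open>?T x\<close> by \<open>?T x + y\<close>, because \<open>?T\<close> is a linear
      involution.\<close>
    show "(\<integral>\<^sup>+x. indicator A (?T x) * indicator ?B (y - ?T x) \<partial>lborel)
       = (\<integral>\<^sup>+x. indicator A (?T x + y) * indicator ?B (- ?T x) \<partial>lborel)"
      by (subst nn_integral_lborel_translate[of _ "?T y", symmetric])
         (auto simp: T_add add.commute)
  qed
  also have "\<dots> = (\<integral>\<^sup>+x. (\<integral>\<^sup>+y. indicator A (?T x + y) * indicator ?B (- ?T x) \<partial>lborel) \<partial>lborel)"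
    by (rule lborel_pair.Fubini'[symmetric]) measurable
  also have "\<dots> = (\<integral>\<^sup>+x. emeasure lborel A * indicator ?B x \<partial>lborel)"
  proof (intro nn_integral_cong)
    fix x :: 'a
    have "indicator ?B (- ?T x) = (indicator ?B x :: ennreal)"
      by (auto simp: indicator_def)
    then show "(\<integral>\<^sup>+y. indicator A (?T x + y) * indicator ?B (- ?T x) \<partial>lborel) = emeasure lborel A * indicator ?B x"
      using nn_integral_lborel_translate[of "indicator A" "?T x"]
      by (subst nn_integral_multc) auto
  qed
  also have "\<dots> = c * emeasure lborel A"
    by (subst nn_integral_cmult) (auto simp: c_def mult.commute)
  finally have "emeasure lborel (?T -` A) = emeasure lborel A"
    using c by (simp add: ennreal_mult_cancel_left)
  then show "emeasure (distr lborel borel ?T) A = emeasure lborel A"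
    by (subst emeasure_distr) auto
qed simp

section \<open>Directions orthogonal to z and their distribution\<close>

text \<open>For a unit vector \<open>z\<close> the value at multiples of \<open>z\<close> is 0. For
  \<open>z = 0\<close> this is the radial projection, so one construction covers both kinds of
  spheres.\<close>

definition perp_dir :: "'a::euclidean_space \<Rightarrow> 'a \<Rightarrow> 'a" where
  "perp_dir z x = (x - (x \<bullet> z) *\<^sub>R z) /\<^sub>R norm (x - (x \<bullet> z) *\<^sub>R z)"

text \<open>Only two cases of \<open>z\<close> matter: for a unit vector this is the uniform distribution on the
sphere of the orthogonal hyperplane, for \<open>z = 0\<close> on the full sphere.\<close>

definition perp_sphere_measure :: "'a::euclidean_space \<Rightarrow> 'a measure" where
  "perp_sphere_measure z = distr (uniform_measure lborel (ball 0 1)) borel (perp_dir z)"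

lemma sphere_sigma_eq: "sphere_sigma = perp_sphere_measure 0"
  by (simp add: sphere_sigma_def perp_sphere_measure_def perp_dir_def[abs_def])

lemma borel_measurable_perp_dir [measurable]: "perp_dir z \<in> borel_measurable borel"
  unfolding perp_dir_def[abs_def] by measurable

text \<open>Such a reflection fixes \<open>z\<close>. This equivariance carries the symmetry of the
  ball over to \<open>perp_sphere_measure\<close>.\<close>

lemma perp_dir_hrefl:
  assumes "z \<bullet> a = 0"
  shows "perp_dir z (hrefl a x) = hrefl a (perp_dir z x)"
proof -
  have z: "hrefl a z = z" using assms by (rule hrefl_orthogonal)
  have "hrefl a x - (hrefl a x \<bullet> z) *\<^sub>R z = hrefl a (x - (x \<bullet> z) *\<^sub>R z)"
    using z by (simp add: linear_diff[OF linear_hrefl] linear_scale[OF linear_hrefl] inner_hrefl_left)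
  then show ?thesis by (simp add: perp_dir_def linear_scale[OF linear_hrefl])
qed

lemma norm_perp_dir: "x - (x \<bullet> z) *\<^sub>R z \<noteq> 0 \<Longrightarrow> norm (perp_dir z x) = 1"
  by (simp add: perp_dir_def)

lemma norm_perp_dir_le: "norm (perp_dir z x) \<le> 1"
  by (cases "x - (x \<bullet> z) *\<^sub>R z = 0") (simp_all add: norm_perp_dir, simp add: perp_dir_def)

lemma inner_perp_dir: "norm z = 1 \<Longrightarrow> z \<bullet> perp_dir z x = 0"
  by (simp add: perp_dir_def inner_diff_right norm_eq_1 inner_commute)

lemma uniform_ball_hrefl:
  "distr (uniform_measure lborel (ball 0 1)) borel (hrefl a) = uniform_measure lborel (ball (0::'a::euclidean_space) 1)"
    (is "distr ?U _ ?T = _")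
proof (rule measure_eqI)
  fix A assume "A \<in> sets (distr ?U borel ?T)"
  then have [measurable]: "A \<in> sets borel" by simp
  have "ball 0 1 \<inter> ?T -` A = ?T -` (ball 0 1 \<inter> A)" by auto
  then have "emeasure lborel (ball 0 1 \<inter> ?T -` A) = emeasure (distr lborel borel ?T) (ball 0 1 \<inter> A)"
    by (subst emeasure_distr) auto
  moreover have "?T -` A \<in> sets borel" using measurable_sets_borel[of ?T borel A] by simp
  ultimately show "emeasure (distr ?U borel ?T) A = emeasure ?U A"
    by (simp add: emeasure_distr lborel_distr_hrefl measurable_sets_borel)
qed simp

lemma invariant_perp_sphere_measure:
  fixes z :: "'a::euclidean_space"
  assumes z: "z = 0 \<or> norm z = 1" and dim: "dim {x. z \<bullet> x = 0} = h" and h: "h \<ge> 2"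
  shows "invariant_sphere_prob (perp_sphere_measure z) {x. z \<bullet> x = 0} h"
proof -
  let ?U = "uniform_measure lborel (ball (0::'a) 1)"
  have "emeasure lborel (ball (0::'a) 1) \<noteq> 0" "emeasure lborel (ball (0::'a) 1) \<noteq> \<infinity>"
    using content_ball_pos[of 1 "0::'a"] emeasure_lborel_ball_finite[of "0::'a" 1]
    by (auto simp: measure_def less_top[symmetric])
  then interpret U: prob_space ?U by (rule prob_space_uniform_measure)
  interpret M: prob_space "perp_sphere_measure z"
    unfolding perp_sphere_measure_def by (rule U.prob_space_distr) simp
  \<comment> \<open>The direction degenerates only on the span of \<open>z\<close>, which is a null
    set because the space has dimension at least 2.\<close>
  have "dim (span {z}) \<le> 1" using dim_le_card'[of "{z}"] by simp
  moreover have "DIM('a) \<ge> 2" using dim h dim_subset_UNIV[of "{x. z \<bullet> x = 0}"] by simp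
  ultimately have "negligible (span {z})" by (intro negligible_lowdim) simp
  then have "span {z} \<in> null_sets lborel"
    by (simp add: negligible_iff_null_sets null_sets_completion_iff borel_closed)
  then have "AE x in lborel. x \<notin> span {z}" by (rule AE_not_in)
  then have ne: "AE x in ?U. x - (x \<bullet> z) *\<^sub>R z \<noteq> 0"
  proof (intro AE_uniform_measureI, simp, eventually_elim)
    case (elim x)
    have "x = (x \<bullet> z) *\<^sub>R z \<Longrightarrow> x \<in> span {z}" by (metis span_base span_scale singletonI)
    with elim show ?case by auto
  qed
  show ?thesis
  proof
    show "sets (perp_sphere_measure z) = sets borel" by (simp add: perp_sphere_measure_def)
    show "AE x in perp_sphere_measure z. norm x = 1"
      unfolding perp_sphere_measure_def using ne
      by (subst AE_distr_iff) (auto simp: norm_perp_dir elim: eventually_mono)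
    show "subspace {x. z \<bullet> x = 0}" by (rule subspace_hyperplane)
    show "AE x in perp_sphere_measure z. x \<in> {x. z \<bullet> x = 0}"
      unfolding perp_sphere_measure_def using z
      by (subst AE_distr_iff) (auto simp: inner_perp_dir)
    fix a assume a: "a \<in> {x. z \<bullet> x = 0}"
    have "distr (perp_sphere_measure z) borel (hrefl a) = distr ?U borel (hrefl a \<circ> perp_dir z)"
      unfolding perp_sphere_measure_def by (rule distr_distr) auto
    also have "hrefl a \<circ> perp_dir z = perp_dir z \<circ> hrefl a"
      using a by (auto simp: perp_dir_hrefl)
    also have "distr ?U borel \<dots> = distr (distr ?U borel (hrefl a)) borel (perp_dir z)"
      by (rule distr_distr[symmetric]) auto
    finally show "distr (perp_sphere_measure z) borel (hrefl a) = perp_sphere_measure z"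
      by (simp add: uniform_ball_hrefl perp_sphere_measure_def)
  qed (use dim h in auto)
qed

lemma norm_perp_part:
  fixes x z :: "'a::euclidean_space"
  assumes "norm x = 1" "norm z = 1"
  shows "norm (x - (x \<bullet> z) *\<^sub>R z) = sqrt (1 - (x \<bullet> z)\<^sup>2)"
proof -
  have "(x - (x \<bullet> z) *\<^sub>R z) \<bullet> (x - (x \<bullet> z) *\<^sub>R z) = 1 - (x \<bullet> z)\<^sup>2"
    using assms by (simp add: inner_diff_right inner_diff_left norm_eq_1 inner_commute power2_eq_square)
  then show ?thesis by (simp add: norm_eq_sqrt_inner)
qed

text \<open>The components of x and y orthogonal to z have inner product t - uv and lengths sqrt(1 -
  v^2) and sqrt(1 - u^2), so the quotient in \<open>Qpoly\<close> is the cosine of the angle between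
  them. If a length is 0, the quotient and the inner product of directions are both 0, so the
  identity persists.\<close>

lemma Qpoly_perp_dir:
  fixes x y z :: "'a::euclidean_space"
  assumes "norm x = 1" "norm y = 1" "norm z = 1"
  shows "Qpoly d m (y \<bullet> z) (x \<bullet> z) (x \<bullet> y) =
    sqrt (1 - (y \<bullet> z)\<^sup>2) ^ m * sqrt (1 - (x \<bullet> z)\<^sup>2) ^ m * gegenbauer (d - 1) m (perp_dir z x \<bullet> perp_dir z y)"
proof -
  have "(x - (x \<bullet> z) *\<^sub>R z) \<bullet> (y - (y \<bullet> z) *\<^sub>R z) = x \<bullet> y - (y \<bullet> z) * (x \<bullet> z)"
    using assms by (simp add: inner_diff_right inner_diff_left norm_eq_1 inner_commute)
  then have "(x \<bullet> y - (y \<bullet> z) * (x \<bullet> z)) / sqrt ((1 - (y \<bullet> z)\<^sup>2) * (1 - (x \<bullet> z)\<^sup>2))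
     = perp_dir z x \<bullet> perp_dir z y"
    using assms by (simp add: perp_dir_def norm_perp_part real_sqrt_mult divide_inverse mult_ac)
  then show ?thesis by (simp add: Qpoly_def real_sqrt_mult power_mult_distrib)
qed

lemma abs_inner_le_1: "norm x = 1 \<Longrightarrow> norm y \<le> 1 \<Longrightarrow> \<bar>x \<bullet> y\<bar> \<le> 1"
  for x y :: "'a::real_inner"
  using Cauchy_Schwarz_ineq2[of x y] by simp

lemma gegenbauer_bounded:
  obtains B where "B \<ge> 0" "\<And>t. \<bar>t\<bar> \<le> 1 \<Longrightarrow> \<bar>gegenbauer h m t\<bar> \<le> B"
  using poly_bounded_on_unit[of "gegenbauer_poly h m"] unfolding gegenbauer_def
  by (metis abs_le_iff minus_le_iff)

lemma borel_measurable_gegenbauer [measurable (raw)]: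
  "f \<in> borel_measurable M \<Longrightarrow> (\<lambda>x. gegenbauer h m (f x)) \<in> borel_measurable M"
  unfolding gegenbauer_def by (rule borel_measurable_poly)

lemma gegenbauer_0: "h \<ge> 2 \<Longrightarrow> gegenbauer h 0 t = 1"
  using degree_gegenbauer_poly[of h 0] gegenbauer_poly_1[of h 0]
  by (auto simp: gegenbauer_def elim!: degree_eq_zeroE)

text \<open>The feature map of the kernel Q for fixed \<open>z\<close>: integrating the product of
  two of these over \<open>w\<close> gives Q up to a positive factor.\<close>

definition perp_zonal :: "nat \<Rightarrow> 'a::euclidean_space \<Rightarrow> 'a \<Rightarrow> 'a \<Rightarrow> real" where
  "perp_zonal m z x w = sqrt (1 - (x \<bullet> z)\<^sup>2) ^ m * gegenbauer (DIM('a) - 1) m (w \<bullet> perp_dir z x)"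

lemma invariant_perp:
  fixes z :: "'a::euclidean_space"
  assumes "DIM('a) \<ge> 3" "norm z = 1"
  shows "invariant_sphere_prob (perp_sphere_measure z) {x. z \<bullet> x = 0} (DIM('a) - 1)"
proof (rule invariant_perp_sphere_measure)
  have "z \<noteq> 0" using assms(2) by auto
  then show "dim {x. z \<bullet> x = 0} = DIM('a) - 1" by (rule dim_hyperplane)
qed (use assms in auto)

lemma invariant_sphere_sigma:
  assumes "DIM('a::euclidean_space) \<ge> 3"
  shows "invariant_sphere_prob (sphere_sigma :: 'a measure) UNIV DIM('a)"
  using invariant_perp_sphere_measure[of "0::'a" "DIM('a)"] assms by (simp add: sphere_sigma_eq)

text \<open>The convolution identity needs unit directions. For m = 0 all functions involved are 1;
  for m >= 1 both sides vanish when x or y is z or -z. The constant is chosen before x and y, which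
  the Gram representation relies on.\<close>

lemma perp_zonal_convolution:
  fixes z :: "'a::euclidean_space"
  assumes d: "DIM('a) \<ge> 3" and z: "norm z = 1"
  obtains c where "c > 0" "\<And>x y. norm x = 1 \<Longrightarrow> norm y = 1 \<Longrightarrow>
    (\<integral>w. perp_zonal m z y w * perp_zonal m z x w \<partial>(perp_sphere_measure z))
     = c * Qpoly DIM('a) m (y \<bullet> z) (x \<bullet> z) (x \<bullet> y)"
proof -
  interpret M: invariant_sphere_prob "perp_sphere_measure z" "{x. z \<bullet> x = 0}" "DIM('a) - 1"
    using d z by (rule invariant_perp)
  show ?thesis
  proof (cases "m = 0")
    case True
    show ?thesis
      by (rule that[of 1])
         (use True d in \<open>simp_all add: perp_zonal_def Qpoly_def gegenbauer_0 M.prob_space[unfolded M.space_M]\<close>)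
  next
    case False
    obtain c where c: "c > 0"
      "\<And>x y. x \<in> {x. z \<bullet> x = 0} \<Longrightarrow> norm x = 1 \<Longrightarrow> y \<in> {x. z \<bullet> x = 0} \<Longrightarrow> norm y = 1 \<Longrightarrow>
      (\<integral>w. gegenbauer (DIM('a) - 1) m (w \<bullet> x) * gegenbauer (DIM('a) - 1) m (w \<bullet> y) \<partial>(perp_sphere_measure z))
       = c * gegenbauer (DIM('a) - 1) m (x \<bullet> y)"
      using M.gegenbauer_convolution[of m] by blast
    show ?thesis
    proof (rule that[of c])
      fix x y :: 'a assume xy: "norm x = 1" "norm y = 1"
      show "(\<integral>w. perp_zonal m z y w * perp_zonal m z x w \<partial>(perp_sphere_measure z))
        = c * Qpoly DIM('a) m (y \<bullet> z) (x \<bullet> z) (x \<bullet> y)"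
      proof (cases "sqrt (1 - (x \<bullet> z)\<^sup>2) = 0 \<or> sqrt (1 - (y \<bullet> z)\<^sup>2) = 0")
        case True
        then show ?thesis
          using False xy z by (auto simp: Qpoly_perp_dir perp_zonal_def power_0_left)
      next
        case False
        then have n: "norm (perp_dir z x) = 1" "norm (perp_dir z y) = 1"
          using norm_perp_part[OF xy(1) z] norm_perp_part[OF xy(2) z] by (auto intro!: norm_perp_dir)
        let ?q = "sqrt (1 - (y \<bullet> z)\<^sup>2) ^ m * sqrt (1 - (x \<bullet> z)\<^sup>2) ^ m"
        let ?g = "gegenbauer (DIM('a) - 1) m"
        have "(\<integral>w. perp_zonal m z y w * perp_zonal m z x w \<partial>(perp_sphere_measure z))
          = (\<integral>w. ?q * (?g (w \<bullet> perp_dir z x) * ?g (w \<bullet> perp_dir z y)) \<partial>(perp_sphere_measure z))"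
          by (intro Bochner_Integration.integral_cong refl) (simp add: perp_zonal_def mult_ac)
        also have "\<dots> = ?q * (c * ?g (perp_dir z x \<bullet> perp_dir z y))"
          using c(2)[of "perp_dir z x" "perp_dir z y"] n z by (simp add: inner_perp_dir)
        also have "\<dots> = c * Qpoly DIM('a) m (y \<bullet> z) (x \<bullet> z) (x \<bullet> y)"
          unfolding Qpoly_perp_dir[OF xy z] by (simp only: mult_ac)
        finally show ?thesis .
      qed
    qed (rule c(1))
  qed
qed

lemma borel_measurable_perp_zonal [measurable (raw)]:
  assumes [measurable]: "f \<in> borel_measurable M" "g \<in> borel_measurable M"
  shows "(\<lambda>x. perp_zonal m z (f x) (g x)) \<in> borel_measurable M"
  unfolding perp_zonal_def by measurable

lemma sqrt_one_minus_power_le: "\<bar>sqrt (1 - t\<^sup>2) ^ m\<bar> \<le> 1" if "\<bar>t\<bar> \<le> 1"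
  using that by (auto simp: abs_square_le_1 intro!: power_le_one)

lemma perp_zonal_bounded:
  fixes z :: "'a::euclidean_space"
  obtains B where "B \<ge> 0" "\<And>x w. norm x = 1 \<Longrightarrow> norm w = 1 \<Longrightarrow> norm z = 1 \<Longrightarrow> \<bar>perp_zonal m z x w\<bar> \<le> B"
proof -
  obtain B where B: "B \<ge> 0" "\<And>t. \<bar>t\<bar> \<le> 1 \<Longrightarrow> \<bar>gegenbauer (DIM('a) - 1) m t\<bar> \<le> B"
    using gegenbauer_bounded by blast
  show ?thesis
  proof (rule that[OF B(1)])
    fix x w :: 'a assume "norm x = 1" "norm w = 1" "norm z = 1"
    then have "\<bar>x \<bullet> z\<bar> \<le> 1" "\<bar>w \<bullet> perp_dir z x\<bar> \<le> 1"
      by (auto intro!: abs_inner_le_1 norm_perp_dir_le)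
    then have "\<bar>perp_zonal m z x w\<bar> \<le> 1 * B"
      unfolding perp_zonal_def abs_mult by (intro mult_mono sqrt_one_minus_power_le B) auto
    then show "\<bar>perp_zonal m z x w\<bar> \<le> B" by simp
  qed
qed

section \<open>Gram representation of the double integral of Y and its pairing with a positive
  semidefinite matrix\<close>

context sphere_prob
begin

lemma abs_integral_le:
  fixes f :: "'a \<Rightarrow> real"
  assumes [measurable]: "f \<in> borel_measurable borel" and f: "\<And>x. norm x = 1 \<Longrightarrow> \<bar>f x\<bar> \<le> B"
  shows "\<bar>\<integral>x. f x \<partial>M\<bar> \<le> B"
proof -
  have "sbounded f" using assms by (auto simp: sbounded_def)
  then have int: "integrable M f" by (rule sbounded_integrable)
  have "\<bar>\<integral>x. f x \<partial>M\<bar> \<le> (\<integral>x. \<bar>f x\<bar> \<partial>M)" by (rule integral_abs_bound)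
  also have "\<dots> \<le> (\<integral>x. B \<partial>M)"
    using int f AE_norm by (intro integral_mono_AE) auto
  finally show ?thesis by (simp add: prob_space[unfolded space_M])
qed

text \<open>Once Q is written as an integral over \<open>w\<close>, the integrand is a product of a
  function of y and a function of x for each \<open>w\<close>. Exchanging integrals separates them
  into the same family of functions, at the indices i and j.\<close>

lemma Yfun_gram:
  fixes z :: 'a
  assumes d: "DIM('a) \<ge> 3" and z: "norm z = 1"
  obtains c \<alpha> where "c > 0" "\<And>i. sbounded (\<alpha> i)"
    "\<And>i j. c * (\<integral>y. (\<integral>x. Yfun DIM('a) m i j x y z \<partial>M) \<partial>M) = (\<integral>w. \<alpha> i w * \<alpha> j w \<partial>(perp_sphere_measure z))"
proof -
  let ?N = "perp_sphere_measure z"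
  interpret N: invariant_sphere_prob ?N "{x. z \<bullet> x = 0}" "DIM('a) - 1"
    using d z by (rule invariant_perp)
  have spM: "sphere_prob M" and spN: "sphere_prob ?N" ..
  obtain c where c: "c > 0" "\<And>x y. norm x = 1 \<Longrightarrow> norm y = 1 \<Longrightarrow>
    (\<integral>w. perp_zonal m z y w * perp_zonal m z x w \<partial>?N) = c * Qpoly DIM('a) m (y \<bullet> z) (x \<bullet> z) (x \<bullet> y)"
    using perp_zonal_convolution[OF d z] by blast
  define P where "P i x = gegenbauer (DIM('a) + 2 * m) i (x \<bullet> z)" for i and x :: 'a
  define a where "a i x w = P i x * perp_zonal m z x w" for i x w
  define \<alpha> where "\<alpha> i w = (\<integral>x. a i x w \<partial>M)" for i w
  have a_meas [measurable (raw)]: "(\<lambda>x. a i (f x) (g x)) \<in> borel_measurable K"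
    if [measurable]: "f \<in> borel_measurable K" "g \<in> borel_measurable K" for i f g and K :: "'b measure"
    unfolding a_def P_def by measurable
  have a_meas2 [measurable]: "(\<lambda>(x, w). a i x w) \<in> borel_measurable (borel \<Otimes>\<^sub>M borel)" for i
    unfolding a_def P_def by measurable
  have "\<exists>B. B \<ge> 0 \<and> (\<forall>x w. norm x = 1 \<longrightarrow> norm w = 1 \<longrightarrow> \<bar>a i x w\<bar> \<le> B)" for i
  proof -
    obtain B where B: "B \<ge> 0" "\<And>x w. norm x = 1 \<Longrightarrow> norm w = 1 \<Longrightarrow> norm z = 1 \<Longrightarrow> \<bar>perp_zonal m z x w\<bar> \<le> B"
      using perp_zonal_bounded[of z m] by blast
    obtain C where C: "C \<ge> 0" "\<And>t. \<bar>t\<bar> \<le> 1 \<Longrightarrow> \<bar>gegenbauer (DIM('a) + 2 * m) i t\<bar> \<le> C"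
      using gegenbauer_bounded by blast
    have "\<bar>a i x w\<bar> \<le> C * B" if "norm x = 1" "norm w = 1" for x w
      unfolding a_def P_def abs_mult using that z B C by (intro mult_mono B C abs_inner_le_1) auto
    then show ?thesis using B(1) C(1) by (intro exI[of _ "C * B"]) auto
  qed
  then obtain B where B: "\<And>i. B i \<ge> 0" "\<And>i x w. norm x = 1 \<Longrightarrow> norm w = 1 \<Longrightarrow> \<bar>a i x w\<bar> \<le> B i"
    by metis
  have \<alpha>_meas [measurable]: "\<alpha> i \<in> borel_measurable borel" for i
    unfolding \<alpha>_def by measurable
  have \<alpha>_bound: "\<bar>\<alpha> i w\<bar> \<le> B i" if "norm w = 1" for i w
  proof -
    show ?thesis unfolding \<alpha>_def by (rule abs_integral_le) (use B that in auto)
  qed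
  show ?thesis
  proof (rule that[OF c(1)])
    show "sbounded (\<alpha> i)" for i using \<alpha>_bound by (auto simp: sbounded_def)
    fix i j
    have inner: "c * (\<integral>x. Yfun DIM('a) m i j x y z \<partial>M) = (\<integral>w. a i y w * \<alpha> j w \<partial>?N)" if y: "norm y = 1" for y
    proof -
      have "c * (\<integral>x. Yfun DIM('a) m i j x y z \<partial>M) = (\<integral>x. c * Yfun DIM('a) m i j x y z \<partial>M)" by simp
      also have "\<dots> = (\<integral>x. (\<integral>w. a i y w * a j x w \<partial>?N) \<partial>M)"
      proof (rule integral_cong_AE)
        show "AE x in M. c * Yfun DIM('a) m i j x y z = (\<integral>w. a i y w * a j x w \<partial>?N)"
          using AE_norm
        proof eventually_elim
          case (elim x)
          have "(\<integral>w. a i y w * a j x w \<partial>?N) = (\<integral>w. P i y * P j x * (perp_zonal m z y w * perp_zonal m z x w) \<partial>?N)"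
            by (intro Bochner_Integration.integral_cong refl) (simp add: a_def mult_ac)
          also have "\<dots> = P i y * P j x * (c * Qpoly DIM('a) m (y \<bullet> z) (x \<bullet> z) (x \<bullet> y))"
            using c(2)[OF elim y] by simp
          finally show ?case by (simp add: Yfun_def P_def mult_ac)
        qed
      qed (unfold Yfun_def Qpoly_def, measurable)
      also have "\<dots> = (\<integral>w. (\<integral>x. a i y w * a j x w \<partial>M) \<partial>?N)"
      proof (rule sphere_Fubini[OF spM spN, where B = "B i * B j"])
        show "\<bar>a i y w * a j x w\<bar> \<le> B i * B j" if "norm x = 1" "norm w = 1" for x w
          unfolding abs_mult by (intro mult_mono B that y) auto
      qed measurable
      finally show ?thesis by (simp add: \<alpha>_def)
    qed
    have "c * (\<integral>y. (\<integral>x. Yfun DIM('a) m i j x y z \<partial>M) \<partial>M) = (\<integral>y. c * (\<integral>x. Yfun DIM('a) m i j x y z \<partial>M) \<partial>M)"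
      by simp
    also have "\<dots> = (\<integral>y. (\<integral>w. a i y w * \<alpha> j w \<partial>?N) \<partial>M)"
    proof (rule integral_cong_AE)
      show "AE y in M. c * (\<integral>x. Yfun DIM('a) m i j x y z \<partial>M) = (\<integral>w. a i y w * \<alpha> j w \<partial>?N)"
        using AE_norm by eventually_elim (rule inner)
    qed (unfold Yfun_def Qpoly_def, measurable)
    also have "\<dots> = (\<integral>w. (\<integral>y. a i y w * \<alpha> j w \<partial>M) \<partial>?N)"
    proof (rule sphere_Fubini[OF spM spN, where B = "B i * B j"])
      show "\<bar>a i y w * \<alpha> j w\<bar> \<le> B i * B j" if "norm y = 1" "norm w = 1" for y w
        unfolding abs_mult by (intro mult_mono B that \<alpha>_bound) auto
    qed measurable
    also have "\<dots> = (\<integral>w. \<alpha> i w * \<alpha> j w \<partial>?N)"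
      by (simp add: \<alpha>_def)
    finally show "c * (\<integral>y. (\<integral>x. Yfun DIM('a) m i j x y z \<partial>M) \<partial>M) = (\<integral>w. \<alpha> i w * \<alpha> j w \<partial>?N)" .
  qed
qed

lemma Yfun_psd_nonneg:
  fixes z :: 'a and A :: "nat \<Rightarrow> nat \<Rightarrow> real"
  assumes d: "DIM('a) \<ge> 3" and z: "norm z = 1" and A: "psd_inf A" "finite {(i, j). A i j \<noteq> 0}"
  shows "0 \<le> (\<Sum>(i, j)\<in>{(i, j). A i j \<noteq> 0}. A i j * (\<integral>y. (\<integral>x. Yfun DIM('a) m i j x y z \<partial>M) \<partial>M))"
proof -
  let ?F = "{(i, j). A i j \<noteq> 0}"
  let ?N = "perp_sphere_measure z"
  interpret N: invariant_sphere_prob ?N "{x. z \<bullet> x = 0}" "DIM('a) - 1"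
    using d z by (rule invariant_perp)
  obtain c \<alpha> where c: "c > 0" and \<alpha>: "\<And>i. sbounded (\<alpha> i)" and
    eq: "\<And>i j. c * (\<integral>y. (\<integral>x. Yfun DIM('a) m i j x y z \<partial>M) \<partial>M) = (\<integral>w. \<alpha> i w * \<alpha> j w \<partial>?N)"
    using Yfun_gram[OF d z] by blast
  \<comment> \<open>\<open>psd_inf\<close> speaks of square index sets, so the support is enlarged
    to a square by zero entries; at each \<open>w\<close> the sum is then the quadratic form of
    \<open>A\<close> at the vector of the values \<open>\<alpha> i w\<close>.\<close>
  define I where "I = fst ` ?F \<union> snd ` ?F"
  have I: "finite I" "?F \<subseteq> I \<times> I"
    using A(2) by (auto simp: I_def intro: rev_image_eqI)
  have "c * (\<Sum>(i, j)\<in>?F. A i j * (\<integral>y. (\<integral>x. Yfun DIM('a) m i j x y z \<partial>M) \<partial>M))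
      = (\<Sum>(i, j)\<in>?F. A i j * (\<integral>w. \<alpha> i w * \<alpha> j w \<partial>?N))"
    unfolding sum_distrib_left by (intro sum.cong refl) (auto simp: eq[symmetric])
  also have "\<dots> = (\<Sum>(i, j)\<in>I \<times> I. A i j * (\<integral>w. \<alpha> i w * \<alpha> j w \<partial>?N))"
    using I by (intro sum.mono_neutral_left) auto
  also have "\<dots> = (\<Sum>i\<in>I. \<Sum>j\<in>I. A i j * (\<integral>w. \<alpha> i w * \<alpha> j w \<partial>?N))"
    by (simp add: sum.cartesian_product)
  also have "\<dots> = (\<integral>w. (\<Sum>i\<in>I. \<Sum>j\<in>I. A i j * (\<alpha> i w * \<alpha> j w)) \<partial>?N)"
    by (subst Bochner_Integration.integral_sum, intro N.sbounded_integrable sbounded_intros \<alpha>,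
        subst Bochner_Integration.integral_sum, intro N.sbounded_integrable sbounded_intros \<alpha>, simp)
  also have "\<dots> \<ge> 0"
  proof (rule integral_nonneg_AE, rule AE_I2)
    fix w
    have "0 \<le> (\<Sum>i\<in>I. \<Sum>j\<in>I. \<alpha> i w * \<alpha> j w * A i j)"
      using A(1) I(1) by (simp add: psd_inf_def)
    then show "0 \<le> (\<Sum>i\<in>I. \<Sum>j\<in>I. A i j * (\<alpha> i w * \<alpha> j w))" by (simp add: mult_ac)
  qed
  finally show ?thesis using c by (simp add: zero_le_mult_iff)
qed

end

section \<open>Vanishing of the integrals of Y over sigma\<close>

lemma gegenbauer_mean_0:
  assumes "invariant_sphere_prob M V h" "e \<in> V" "norm e = 1" "m \<ge> 1"
  shows "(\<integral>w. gegenbauer h m (w \<bullet> e) \<partial>M) = 0"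
proof -
  interpret invariant_sphere_prob M V h by fact
  have "gegen_int h (gegenbauer_poly h m * 1) = 0"
    using gegen_orth_gegenbauer_poly[OF h, of m] assms(4) by (simp only: gegen_orth_def degree_1)
  then show ?thesis
    using integral_poly_inner[OF assms(2,3)] by (simp add: gegenbauer_def gegen_mean_def)
qed

lemma Yfun_sigma_0:
  fixes y z :: "'a::euclidean_space"
  assumes d: "DIM('a) \<ge> 3" and yz: "norm y = 1" "norm z = 1" and mj: "m \<ge> 1 \<or> j \<ge> 1"
  shows "(\<integral>x. Yfun DIM('a) m i j x y z \<partial>sphere_sigma) = 0"
proof (cases "m = 0")
  case True
  \<comment> \<open>For m = 0 the kernel Q is 1 and the parameter d + 2m is d, so what remains over
    \<open>x\<close> is the mean of P_j with j >= 1 on the sphere that it belongs to.\<close>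
  have "gegenbauer (DIM('a) - 1) 0 t = 1" for t using d by (simp add: gegenbauer_0)
  then show ?thesis
    using gegenbauer_mean_0[OF invariant_sphere_sigma[OF d] UNIV_I yz(2), of j] mj True
    by (simp add: Yfun_def Qpoly_def)
next
  case False
  let ?S = "sphere_sigma :: 'a measure" and ?N = "perp_sphere_measure z"
  let ?g = "gegenbauer (DIM('a) - 1) m"
  interpret S: invariant_sphere_prob ?S UNIV "DIM('a)" using d by (rule invariant_sphere_sigma)
  interpret N: invariant_sphere_prob ?N "{x. z \<bullet> x = 0}" "DIM('a) - 1"
    using d yz(2) by (rule invariant_perp)
  have spS: "sphere_prob ?S" and spN: "sphere_prob ?N" ..
  define F where "F x = gegenbauer (DIM('a) + 2 * m) j (x \<bullet> z) * sqrt (1 - (x \<bullet> z)\<^sup>2) ^ m" for x :: 'a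
  have [measurable]: "F \<in> borel_measurable borel" unfolding F_def by measurable
  define G where "G \<eta> = (\<integral>x. F x * ?g (perp_dir z x \<bullet> \<eta>) \<partial>?S)" for \<eta>
  define b where "b = gegenbauer (DIM('a) + 2 * m) i (y \<bullet> z) * sqrt (1 - (y \<bullet> z)\<^sup>2) ^ m"
  have "(\<integral>x. Yfun DIM('a) m i j x y z \<partial>?S) = (\<integral>x. b * (F x * ?g (perp_dir z x \<bullet> perp_dir z y)) \<partial>?S)"
  proof (rule integral_cong_AE)
    show "AE x in ?S. Yfun DIM('a) m i j x y z = b * (F x * ?g (perp_dir z x \<bullet> perp_dir z y))"
      using S.AE_norm by eventually_elim (simp add: Yfun_def Qpoly_perp_dir yz b_def F_def mult_ac)
  qed (unfold Yfun_def Qpoly_def, measurable)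
  also have "\<dots> = b * G (perp_dir z y)" by (simp add: G_def)
  also have "\<dots> = 0"
  proof (cases "sqrt (1 - (y \<bullet> z)\<^sup>2) = 0")
    case True
    then show ?thesis using False by (simp add: b_def)
  next
    case nz: False
    have ny: "norm (perp_dir z y) = 1" using nz norm_perp_part[OF yz] by (auto intro!: norm_perp_dir)
    \<comment> \<open>A reflection fixing \<open>z\<close> exchanges any two admissible \<open>\<eta>\<close>, so \<open>G\<close> equals its own average
      over the sphere orthogonal to \<open>z\<close>, which vanishes by Fubini.\<close>
    have G_const: "G \<eta> = G (perp_dir z y)" if \<eta>: "norm \<eta> = 1" "z \<bullet> \<eta> = 0" for \<eta>
    proof -
      define a where "a = \<eta> - perp_dir z y"
      have za: "z \<bullet> a = 0" using \<eta> yz by (simp add: a_def inner_diff_right inner_perp_dir)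
      have F_a: "F (hrefl a x) = F x" for x
        using za by (simp add: F_def inner_hrefl_left hrefl_orthogonal)
      have "G \<eta> = (\<integral>x. F (hrefl a x) * ?g (perp_dir z (hrefl a x) \<bullet> \<eta>) \<partial>?S)"
        unfolding G_def by (rule S.integral_hrefl[symmetric]) auto
      also have "\<dots> = G (perp_dir z y)"
        using hrefl_swap[of \<eta> "perp_dir z y"] \<eta> ny
        unfolding G_def F_a perp_dir_hrefl[OF za] inner_hrefl_left by (simp add: a_def)
      finally show ?thesis .
    qed
    have "G (perp_dir z y) = (\<integral>\<eta>. G (perp_dir z y) \<partial>?N)"
      by (simp add: N.prob_space[unfolded N.space_M])
    also have "\<dots> = (\<integral>\<eta>. G \<eta> \<partial>?N)"
    proof (rule integral_cong_AE)
      show "AE \<eta> in ?N. G (perp_dir z y) = G \<eta>"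
        using N.AE_norm N.AE_V by eventually_elim (simp add: G_const)
    qed (unfold G_def, measurable)
    also have "\<dots> = (\<integral>x. (\<integral>\<eta>. F x * ?g (perp_dir z x \<bullet> \<eta>) \<partial>?N) \<partial>?S)"
      unfolding G_def
    proof -
      obtain B where B: "B \<ge> 0" "\<And>t. \<bar>t\<bar> \<le> 1 \<Longrightarrow> \<bar>?g t\<bar> \<le> B"
        using gegenbauer_bounded by blast
      obtain C where C: "C \<ge> 0" "\<And>t. \<bar>t\<bar> \<le> 1 \<Longrightarrow> \<bar>gegenbauer (DIM('a) + 2 * m) j t\<bar> \<le> C"
        using gegenbauer_bounded by blast
      show "(\<integral>\<eta>. (\<integral>x. F x * ?g (perp_dir z x \<bullet> \<eta>) \<partial>?S) \<partial>?N) = (\<integral>x. (\<integral>\<eta>. F x * ?g (perp_dir z x \<bullet> \<eta>) \<partial>?N) \<partial>?S)"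
      proof (rule sphere_Fubini[OF spN spS, where B = "C * 1 * B"])
        fix \<eta> x :: 'a assume "norm \<eta> = 1" "norm x = 1"
        then have "\<bar>x \<bullet> z\<bar> \<le> 1" "\<bar>perp_dir z x \<bullet> \<eta>\<bar> \<le> 1"
          using abs_inner_le_1[of \<eta> "perp_dir z x"] abs_inner_le_1[of x z] norm_perp_dir_le yz
          by (auto simp: inner_commute)
        then show "\<bar>F x * ?g (perp_dir z x \<bullet> \<eta>)\<bar> \<le> C * 1 * B"
          unfolding F_def abs_mult by (intro mult_mono B C sqrt_one_minus_power_le) (use B(1) C(1) in auto)
      qed measurable
    qed
    also have "\<dots> = (\<integral>x. 0 \<partial>?S)"
    proof (rule integral_cong_AE)
      show "AE x in ?S. (\<integral>\<eta>. F x * ?g (perp_dir z x \<bullet> \<eta>) \<partial>?N) = 0"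
        using S.AE_norm
      proof eventually_elim
        case (elim x)
        show ?case
        proof (cases "sqrt (1 - (x \<bullet> z)\<^sup>2) = 0")
          case True
          then show ?thesis using False by (simp add: F_def)
        next
          case nx: False
          have "norm (perp_dir z x) = 1" using nx norm_perp_part[OF elim yz(2)] by (auto intro!: norm_perp_dir)
          then have "(\<integral>\<eta>. ?g (\<eta> \<bullet> perp_dir z x) \<partial>?N) = 0"
            using False yz by (intro gegenbauer_mean_0[OF invariant_perp[OF d yz(2)]]) (auto simp: inner_perp_dir)
          then show ?thesis by (simp add: inner_commute)
        qed
      qed
    qed measurable
    finally show ?thesis by simp
  qed
  finally show ?thesis .
qed

subsection \<open>Energies\<close>

definition sbounded3 :: "('a::euclidean_space \<Rightarrow> 'a \<Rightarrow> 'a \<Rightarrow> real) \<Rightarrow> bool" where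
  "sbounded3 k \<longleftrightarrow> (\<lambda>p. k (fst p) (fst (snd p)) (snd (snd p))) \<in> borel_measurable (borel \<Otimes>\<^sub>M borel \<Otimes>\<^sub>M borel) \<and>
     (\<exists>B. \<forall>x y z. norm x = 1 \<longrightarrow> norm y = 1 \<longrightarrow> norm z = 1 \<longrightarrow> \<bar>k x y z\<bar> \<le> B)"

lemma sbounded3_measurable:
  assumes "sbounded3 k" and [measurable]: "f \<in> borel_measurable M" "g \<in> borel_measurable M" "h \<in> borel_measurable M"
  shows "(\<lambda>x. k (f x) (g x) (h x)) \<in> borel_measurable M"
proof -
  have "(\<lambda>x. (f x, g x, h x)) \<in> M \<rightarrow>\<^sub>M borel \<Otimes>\<^sub>M borel \<Otimes>\<^sub>M borel" by measurable
  from measurable_compose[OF this, of "\<lambda>p. k (fst p) (fst (snd p)) (snd (snd p))"] assms(1)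
  show ?thesis by (simp add: sbounded3_def)
qed

lemma sbounded3_swap12:
  assumes "sbounded3 k" shows "sbounded3 (\<lambda>x y z. k y x z)"
  using assms sbounded3_measurable[OF assms, of "\<lambda>p. fst (snd p)" "borel \<Otimes>\<^sub>M borel \<Otimes>\<^sub>M borel" "\<lambda>p. fst p" "\<lambda>p. snd (snd p)"]
  unfolding sbounded3_def by (auto; metis)

lemma sbounded3_swap23:
  assumes "sbounded3 k" shows "sbounded3 (\<lambda>x y z. k x z y)"
  using assms sbounded3_measurable[OF assms, of "\<lambda>p. fst p" "borel \<Otimes>\<^sub>M borel \<Otimes>\<^sub>M borel" "\<lambda>p. snd (snd p)" "\<lambda>p. fst (snd p)"]
  unfolding sbounded3_def by (auto; metis)

text \<open>The argument of the Gegenbauer polynomial in Q stays in [-1,1] because it is an inner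
  product of two vectors of norm at most 1.\<close>

lemma sbounded3_Yfun: "sbounded3 (Yfun d m i j :: 'a::euclidean_space \<Rightarrow> 'a \<Rightarrow> 'a \<Rightarrow> real)"
  unfolding sbounded3_def
proof
  show "(\<lambda>p. Yfun d m i j (fst p) (fst (snd p)) (snd (snd p) :: 'a)) \<in> borel_measurable (borel \<Otimes>\<^sub>M borel \<Otimes>\<^sub>M borel)"
    unfolding Yfun_def Qpoly_def by measurable
  obtain B1 where B1: "B1 \<ge> 0" "\<And>t. \<bar>t\<bar> \<le> 1 \<Longrightarrow> \<bar>gegenbauer (d + 2 * m) i t\<bar> \<le> B1"
    using gegenbauer_bounded by blast
  obtain B2 where B2: "B2 \<ge> 0" "\<And>t. \<bar>t\<bar> \<le> 1 \<Longrightarrow> \<bar>gegenbauer (d + 2 * m) j t\<bar> \<le> B2"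
    using gegenbauer_bounded by blast
  obtain B3 where B3: "B3 \<ge> 0" "\<And>t. \<bar>t\<bar> \<le> 1 \<Longrightarrow> \<bar>gegenbauer (d - 1) m t\<bar> \<le> B3"
    using gegenbauer_bounded by blast
  have "\<bar>Yfun d m i j x y z\<bar> \<le> B1 * B2 * (1 * 1 * B3)"
    if n: "norm x = 1" "norm y = 1" "norm z = 1" for x y z :: 'a
  proof -
    have "\<bar>perp_dir z x \<bullet> perp_dir z y\<bar> \<le> norm (perp_dir z x) * norm (perp_dir z y)"
      by (rule Cauchy_Schwarz_ineq2)
    also have "\<dots> \<le> 1 * 1" by (intro mult_mono norm_perp_dir_le) auto
    finally have le: "\<bar>perp_dir z x \<bullet> perp_dir z y\<bar> \<le> 1" by simp
    show ?thesis
      unfolding Yfun_def Qpoly_perp_dir[OF n] abs_mult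
      using n B1(1) B2(1) B3(1)
      by (intro mult_mono mult_nonneg_nonneg B1 B2 B3 sqrt_one_minus_power_le abs_inner_le_1 le) auto
  qed
  then show "\<exists>B. \<forall>x y z. norm (x::'a) = 1 \<longrightarrow> norm (y::'a) = 1 \<longrightarrow> norm (z::'a) = 1 \<longrightarrow> \<bar>Yfun d m i j x y z\<bar> \<le> B"
    by blast
qed

lemma sbounded3_add:
  assumes "sbounded3 k" "sbounded3 l"
  shows "sbounded3 (\<lambda>x y z. k x y z + l x y z)"
proof -
  obtain B where B: "\<And>x y z. norm x = 1 \<Longrightarrow> norm y = 1 \<Longrightarrow> norm z = 1 \<Longrightarrow> \<bar>k x y z\<bar> \<le> B"
    using assms(1) by (auto simp: sbounded3_def)
  obtain C where C: "\<And>x y z. norm x = 1 \<Longrightarrow> norm y = 1 \<Longrightarrow> norm z = 1 \<Longrightarrow> \<bar>l x y z\<bar> \<le> C"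
    using assms(2) by (auto simp: sbounded3_def)
  have "\<bar>k x y z + l x y z\<bar> \<le> B + C" if "norm x = 1" "norm y = 1" "norm z = 1" for x y z
    using B[OF that] C[OF that] by (meson abs_triangle_ineq add_mono order_trans)
  then show ?thesis using assms unfolding sbounded3_def by (auto intro!: borel_measurable_add)
qed

lemma sbounded3_cmult:
  assumes "sbounded3 k"
  shows "sbounded3 (\<lambda>x y z. c * k x y z)"
proof -
  obtain B where "\<And>x y z. norm x = 1 \<Longrightarrow> norm y = 1 \<Longrightarrow> norm z = 1 \<Longrightarrow> \<bar>k x y z\<bar> \<le> B"
    using assms by (auto simp: sbounded3_def)
  then have "\<bar>c * k x y z\<bar> \<le> \<bar>c\<bar> * B" if "norm x = 1" "norm y = 1" "norm z = 1" for x y z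
    using that by (simp add: abs_mult mult_left_mono)
  then show ?thesis using assms unfolding sbounded3_def by (auto intro!: borel_measurable_times)
qed

lemma sbounded3_sum:
  "(\<And>i. i \<in> I \<Longrightarrow> sbounded3 (k i)) \<Longrightarrow> sbounded3 (\<lambda>x y z. \<Sum>i\<in>I. k i x y z)"
proof (induction I rule: infinite_finite_induct)
  case (insert i I)
  then show ?case by (auto intro!: sbounded3_add)
qed (auto simp: sbounded3_def)

text \<open>Two adjacent transpositions generate all permutations of three arguments; the energies
  are compared along the same chain.\<close>

lemma sbounded3_Yfun_permuted:
  "sbounded3 (\<lambda>x y z. Yfun d m i j x z y)" "sbounded3 (\<lambda>x y z. Yfun d m i j y x z)"
  "sbounded3 (\<lambda>x y z. Yfun d m i j y z x)" "sbounded3 (\<lambda>x y z. Yfun d m i j z x y)"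
  "sbounded3 (\<lambda>x y z. Yfun d m i j z y x)"
proof -
  show 1: "sbounded3 (\<lambda>x y z. Yfun d m i j x z y)" by (rule sbounded3_swap23[OF sbounded3_Yfun])
  show 2: "sbounded3 (\<lambda>x y z. Yfun d m i j y x z)" by (rule sbounded3_swap12[OF sbounded3_Yfun])
  show 3: "sbounded3 (\<lambda>x y z. Yfun d m i j y z x)" by (rule sbounded3_swap12[OF 1])
  show "sbounded3 (\<lambda>x y z. Yfun d m i j z x y)" by (rule sbounded3_swap23[OF 2])
  show "sbounded3 (\<lambda>x y z. Yfun d m i j z y x)" by (rule sbounded3_swap23[OF 3])
qed

lemma sbounded3_Sfun: "sbounded3 (Sfun d m i j)"
proof -
  have "sbounded3 (\<lambda>x y z. 1 / 6 * (Yfun d m i j x y z + Yfun d m i j x z y + Yfun d m i j y x z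
       + Yfun d m i j y z x + Yfun d m i j z x y + Yfun d m i j z y x))"
    by (intro sbounded3_cmult sbounded3_add sbounded3_Yfun sbounded3_Yfun_permuted)
  then show ?thesis by (simp add: Sfun_def[abs_def])
qed

lemma sbounded3_kernelK: "sbounded3 (kernelK A n :: 'a::euclidean_space \<Rightarrow> 'a \<Rightarrow> 'a \<Rightarrow> real)"
proof -
  have "sbounded3 (\<lambda>x y z :: 'a. \<Sum>m\<le>n. \<Sum>p\<in>{(i, j). A m i j \<noteq> 0}.
      A m (fst p) (snd p) * Sfun DIM('a) m (fst p) (snd p) x y z)"
    by (intro sbounded3_sum sbounded3_cmult sbounded3_Sfun)
  then show ?thesis by (simp add: kernelK_def[abs_def] split_beta mult.commute)
qed

section \<open>Energies as integrals over the triple product, and their invariance under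
  permutations\<close>

context sphere_prob
begin

lemma sbounded3_integrable:
  assumes "sbounded3 k"
  shows "integrable (M \<Otimes>\<^sub>M M \<Otimes>\<^sub>M M) (\<lambda>(z, y, x). k x y z)"
proof -
  note [measurable (raw)] = sbounded3_measurable[OF assms]
  interpret MM: pair_prob_space M M ..
  interpret MMM: pair_prob_space M "M \<Otimes>\<^sub>M M" ..
  obtain B where B: "\<And>x y z. norm x = 1 \<Longrightarrow> norm y = 1 \<Longrightarrow> norm z = 1 \<Longrightarrow> \<bar>k x y z\<bar> \<le> B"
    using assms by (auto simp: sbounded3_def)
  have "AE p in M \<Otimes>\<^sub>M M. norm (fst p) = 1 \<and> norm (snd p) = 1"
    by (rule MM.AE_pair_measure) (use AE_norm in \<open>auto elim: eventually_mono\<close>)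
  then have "AE p in M \<Otimes>\<^sub>M (M \<Otimes>\<^sub>M M). norm (fst p) = 1 \<and> norm (fst (snd p)) = 1 \<and> norm (snd (snd p)) = 1"
    by (intro MMM.AE_pair_measure) (use AE_norm in \<open>auto elim: eventually_mono\<close>)
  then have "AE p in M \<Otimes>\<^sub>M M \<Otimes>\<^sub>M M. norm ((\<lambda>(z, y, x). k x y z) p) \<le> B"
    by eventually_elim (auto simp: B)
  then show ?thesis by (rule MMM.integrable_const_bound) measurable
qed

text \<open>On the product measure a single integrability fact gives linearity in the kernel,
  instead of one at each level of the iterated integral.\<close>

lemma energy_eq:
  assumes "sbounded3 k"
  shows "energy k M = (\<integral>(z, y, x). k x y z \<partial>(M \<Otimes>\<^sub>M M \<Otimes>\<^sub>M M))"
proof -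
  note [measurable (raw)] = sbounded3_measurable[OF assms]
  interpret MM: pair_prob_space M M ..
  interpret MMM: pair_prob_space M "M \<Otimes>\<^sub>M M" ..
  note int = sbounded3_integrable[OF assms]
  have "(\<integral>p. (case p of (z, y, x) \<Rightarrow> k x y z) \<partial>(M \<Otimes>\<^sub>M M \<Otimes>\<^sub>M M))
      = (\<integral>z. (\<integral>q. (case q of (y, x) \<Rightarrow> k x y z) \<partial>(M \<Otimes>\<^sub>M M)) \<partial>M)"
    using MMM.integral_fst'[OF int] by simp
  also have "\<dots> = (\<integral>z. (\<integral>y. (\<integral>x. k x y z \<partial>M) \<partial>M) \<partial>M)"
  proof (rule integral_cong_AE)
    show "AE z in M. (\<integral>q. (case q of (y, x) \<Rightarrow> k x y z) \<partial>(M \<Otimes>\<^sub>M M)) = (\<integral>y. (\<integral>x. k x y z \<partial>M) \<partial>M)"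
      using MMM.AE_integrable_fst'[OF int]
    proof eventually_elim
      case (elim z)
      then show ?case using MM.integral_fst'[of "\<lambda>(y, x). k x y z"] by simp
    qed
  qed measurable
  finally show ?thesis by (simp add: energy_def)
qed

lemma energy_swap12:
  assumes k: "sbounded3 k"
  shows "energy (\<lambda>x y z. k y x z) M = energy k M"
proof -
  note [measurable (raw)] = sbounded3_measurable[OF k]
  obtain B where B: "\<And>x y z. norm x = 1 \<Longrightarrow> norm y = 1 \<Longrightarrow> norm z = 1 \<Longrightarrow> \<bar>k x y z\<bar> \<le> B"
    using k by (auto simp: sbounded3_def)
  have sp: "sphere_prob M" ..
  show ?thesis
    unfolding energy_def
  proof (rule integral_cong_AE)
    show "AE z in M. (\<integral>y. (\<integral>x. k y x z \<partial>M) \<partial>M) = (\<integral>y. (\<integral>x. k x y z \<partial>M) \<partial>M)"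
      using AE_norm
    proof eventually_elim
      case (elim z)
      show ?case by (rule sphere_Fubini[OF sp sp, where B = B]) (measurable, use B elim in auto)
    qed
  qed measurable
qed

text \<open>Fubini is applied to the two outer integrals, with the inner integral as a kernel that
  inherits the bound of \<open>k\<close>.\<close>

lemma energy_swap23:
  assumes k: "sbounded3 k"
  shows "energy (\<lambda>x y z. k x z y) M = energy k M"
proof -
  note [measurable (raw)] = sbounded3_measurable[OF k]
  obtain B where B: "\<And>x y z. norm x = 1 \<Longrightarrow> norm y = 1 \<Longrightarrow> norm z = 1 \<Longrightarrow> \<bar>k x y z\<bar> \<le> B"
    using k by (auto simp: sbounded3_def)
  have sp: "sphere_prob M" ..
  show ?thesis
    unfolding energy_def
  proof (rule sphere_Fubini[OF sp sp, where B = B])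
    fix z y :: 'a assume "norm z = 1" "norm y = 1"
    then show "\<bar>\<integral>x. k x z y \<partial>M\<bar> \<le> B" by (intro abs_integral_le) (auto simp: B)
  qed measurable
qed

lemma energy_Sfun: "energy (Sfun d m i j) M = energy (Yfun d m i j) M"
proof -
  let ?M3 = "M \<Otimes>\<^sub>M M \<Otimes>\<^sub>M M"
  let ?Y = "Yfun d m i j :: 'a \<Rightarrow> 'a \<Rightarrow> 'a \<Rightarrow> real"
  note b = sbounded3_Yfun[of d m i j] sbounded3_Yfun_permuted[of d m i j]
  note int = b[THEN sbounded3_integrable]
  have e1: "energy (\<lambda>x y z. ?Y x z y) M = energy ?Y M" by (rule energy_swap23[OF b(1)])
  have e2: "energy (\<lambda>x y z. ?Y y x z) M = energy ?Y M" by (rule energy_swap12[OF b(1)])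
  have e3: "energy (\<lambda>x y z. ?Y y z x) M = energy ?Y M" using energy_swap12[OF b(2)] e1 by simp
  have e4: "energy (\<lambda>x y z. ?Y z x y) M = energy ?Y M" using energy_swap23[OF b(3)] e2 by simp
  have e5: "energy (\<lambda>x y z. ?Y z y x) M = energy ?Y M" using energy_swap23[OF b(4)] e3 by simp
  have "energy (Sfun d m i j) M = (\<integral>p. ((case p of (z, y, x) \<Rightarrow> ?Y x y z) + (case p of (z, y, x) \<Rightarrow> ?Y x z y)
     + (case p of (z, y, x) \<Rightarrow> ?Y y x z) + (case p of (z, y, x) \<Rightarrow> ?Y y z x)
     + (case p of (z, y, x) \<Rightarrow> ?Y z x y) + (case p of (z, y, x) \<Rightarrow> ?Y z y x)) / 6 \<partial>?M3)"
    unfolding energy_eq[OF sbounded3_Sfun]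
    by (intro Bochner_Integration.integral_cong refl) (auto simp: Sfun_def)
  also have "\<dots> = energy ?Y M"
    using int e1 e2 e3 e4 e5 by (simp add: b[THEN energy_eq])
  finally show ?thesis .
qed

lemma energy_kernelK:
  "energy (kernelK A n) M = (\<Sum>m\<le>n. \<Sum>(i, j)\<in>{(i, j). A m i j \<noteq> 0}. A m i j * energy (Yfun DIM('a) m i j) M)"
proof -
  let ?M3 = "M \<Otimes>\<^sub>M M \<Otimes>\<^sub>M M"
  define S where "S m i j = (\<lambda>(z, y, x). Sfun DIM('a) m i j x y (z::'a))" for m i j
  have S_int: "integrable ?M3 (S m i j)" for m i j
    unfolding S_def by (rule sbounded3_integrable[OF sbounded3_Sfun])
  have S_eq: "(\<integral>p. S m i j p \<partial>?M3) = energy (Yfun DIM('a) m i j) M" for m i j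
    unfolding S_def using energy_eq[OF sbounded3_Sfun] energy_Sfun by simp
  have "energy (kernelK A n) M = (\<integral>(z, y, x). kernelK A n x y z \<partial>?M3)"
    by (rule energy_eq[OF sbounded3_kernelK])
  also have "\<dots> = (\<integral>p. (\<Sum>m\<le>n. \<Sum>q\<in>{(i, j). A m i j \<noteq> 0}. A m (fst q) (snd q) * S m (fst q) (snd q) p) \<partial>?M3)"
    by (intro Bochner_Integration.integral_cong refl)
       (auto simp: kernelK_def S_def split_beta mult.commute)
  also have "\<dots> = (\<Sum>m\<le>n. \<Sum>q\<in>{(i, j). A m i j \<noteq> 0}. A m (fst q) (snd q) * (\<integral>p. S m (fst q) (snd q) p \<partial>?M3))"
    by (simp add: S_int)
  finally show ?thesis by (simp add: S_eq split_beta)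
qed

end

section \<open>Nonnegativity for every measure, and the value 0 for sigma\<close>

lemma sphere_prob_of_prob_on_sphere:
  assumes "prob_on_sphere \<mu>"
  shows "sphere_prob \<mu>"
proof -
  interpret prob_space \<mu> using assms by (simp add: prob_on_sphere_def)
  have sets: "sets \<mu> = sets borel" and "prob (sphere 0 1) = 1"
    using assms by (auto simp: prob_on_sphere_def measure_def)
  then have "AE x in \<mu>. x \<in> sphere 0 1"
    by (subst AE_in_set_eq_1) auto
  then show ?thesis
    by unfold_locales (auto simp: sets elim: eventually_mono)
qed

lemma (in sphere_prob) sbounded_inner_integrals:
  assumes k: "sbounded3 k"
  shows "sbounded (\<lambda>z. \<integral>y. (\<integral>x. k x y z \<partial>M) \<partial>M)"
proof -
  note [measurable (raw)] = sbounded3_measurable[OF k]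
  obtain B where B: "\<And>x y z. norm x = 1 \<Longrightarrow> norm y = 1 \<Longrightarrow> norm z = 1 \<Longrightarrow> \<bar>k x y z\<bar> \<le> B"
    using k by (auto simp: sbounded3_def)
  have "\<bar>\<integral>y. (\<integral>x. k x y z \<partial>M) \<partial>M\<bar> \<le> B" if "norm z = 1" for z
    by (intro abs_integral_le) (use B that in auto)
  then show ?thesis unfolding sbounded_def by auto
qed

lemma (in sphere_prob) energy_kernelK_nonneg:
  assumes d: "DIM('a) \<ge> 3"
    and A: "\<And>m. m \<le> n \<Longrightarrow> psd_inf (A m)"
    and fin: "\<And>m. m \<le> n \<Longrightarrow> finite {(i, j). A m i j \<noteq> 0}"
  shows "0 \<le> energy (kernelK A n) M"
proof -
  define T where "T m i j z = (\<integral>y. (\<integral>x. Yfun DIM('a) m i j x y (z::'a) \<partial>M) \<partial>M)" for m i j z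
  have T_sb: "sbounded (T m i j)" for m i j
    unfolding T_def by (rule sbounded_inner_integrals[OF sbounded3_Yfun])
  have "0 \<le> (\<Sum>(i, j)\<in>{(i, j). A m i j \<noteq> 0}. A m i j * energy (Yfun DIM('a) m i j) M)" if "m \<le> n" for m
  proof -
    \<comment> \<open>Only the whole sum over (i, j) is known to be nonnegative at each
      \<open>z\<close>, not its single terms, so the sum is kept under the outer integral.\<close>
    have "0 \<le> (\<integral>z. (\<Sum>p\<in>{(i, j). A m i j \<noteq> 0}. A m (fst p) (snd p) * T m (fst p) (snd p) z) \<partial>M)"
    proof (rule integral_nonneg_AE)
      show "AE z in M. 0 \<le> (\<Sum>p\<in>{(i, j). A m i j \<noteq> 0}. A m (fst p) (snd p) * T m (fst p) (snd p) z)"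
        using AE_norm
      proof eventually_elim
        case (elim z)
        then show ?case using Yfun_psd_nonneg[OF d elim A[OF that] fin[OF that]]
          by (simp add: T_def split_beta)
      qed
    qed
    also have "\<dots> = (\<Sum>p\<in>{(i, j). A m i j \<noteq> 0}. A m (fst p) (snd p) * (\<integral>z. T m (fst p) (snd p) z \<partial>M))"
      by (simp add: sbounded_integrable[OF T_sb])
    finally show ?thesis by (simp add: T_def energy_def split_beta)
  qed
  then show ?thesis unfolding energy_kernelK by (intro sum_nonneg[of "{..n}"]) simp
qed

lemma energy_kernelK_sigma:
  assumes d: "DIM('a::euclidean_space) \<ge> 3" and A0: "\<And>i. A 0 i 0 = 0"
  shows "energy (kernelK A n) (sphere_sigma :: 'a measure) = 0"
proof -
  let ?S = "sphere_sigma :: 'a measure"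
  interpret S: invariant_sphere_prob ?S UNIV "DIM('a)"
    using d by (rule invariant_sphere_sigma)
  have "energy (Yfun DIM('a) m i j) ?S = 0" if "A m i j \<noteq> 0" for m i j
  proof -
    \<comment> \<open>The first column of A_0 is zero, so a nonzero entry with m = 0 has j >= 1; the
      index j matters because it belongs to the factor in x, the innermost variable.\<close>
    have mj: "m \<ge> 1 \<or> j \<ge> 1" using that A0 by (metis One_nat_def Suc_leI neq0_conv)
    note [measurable (raw)] = sbounded3_measurable[OF sbounded3_Yfun]
    have "energy (Yfun DIM('a) m i j) ?S
        = (\<integral>z. (\<integral>y. 0 \<partial>?S) \<partial>?S)"
      unfolding energy_def
    proof (rule integral_cong_AE)
      show "AE z in ?S. (\<integral>y. (\<integral>x. Yfun DIM('a) m i j x y z \<partial>?S) \<partial>?S)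
          = (\<integral>y. 0 \<partial>?S)"
        using S.AE_norm
      proof eventually_elim
        case (elim z)
        show ?case
        proof (rule integral_cong_AE)
          show "AE y in ?S. (\<integral>x. Yfun DIM('a) m i j x y z \<partial>?S) = 0"
            using S.AE_norm by eventually_elim (intro Yfun_sigma_0 d elim mj)
        qed measurable
      qed
    qed measurable
    then show ?thesis by simp
  qed
  moreover have "energy (kernelK A n) ?S
      = (\<Sum>m\<le>n. \<Sum>(i, j)\<in>{(i, j). A m i j \<noteq> 0}. A m i j * energy (Yfun DIM('a) m i j) ?S)"
    by (rule S.energy_kernelK)
  moreover have "\<dots> = 0" using calculation(1) by (intro sum.neutral ballI) auto
  ultimately show ?thesis by simp
qed

theorem theorem4p2:
  fixes A :: "nat \<Rightarrow> nat \<Rightarrow> nat \<Rightarrow> real" and n :: nat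
  assumes "DIM('a::euclidean_space) \<ge> 3"
    and "\<And>m. m \<le> n \<Longrightarrow> psd_inf (A m)"
    and "\<And>m. m \<le> n \<Longrightarrow> finite {(i, j). A m i j \<noteq> 0}"
    and "\<And>j. A 0 0 j = 0" and "\<And>i. A 0 i 0 = 0"
    and "prob_on_sphere (\<mu> :: 'a measure)"
  shows "energy (kernelK A n) (sphere_sigma :: 'a measure) \<le> energy (kernelK A n) \<mu>"
proof -
  interpret sphere_prob \<mu> using assms(6) by (rule sphere_prob_of_prob_on_sphere)
  have "energy (kernelK A n) (sphere_sigma :: 'a measure) = 0"
    using assms(1,5) by (rule energy_kernelK_sigma)
  also have "0 \<le> energy (kernelK A n) \<mu>"
    using assms(1-3) by (rule energy_kernelK_nonneg)
  finally show ?thesis .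
qed

end
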